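(* Suppose $\mathfrak{C}=\mathfrak{C}_{AR(1)}$, the weights $w(j,n)$ are admissible, and $(X,R)$ satisfies the rank condition. For $0<C<\infty$ let $W(C)=\{y\in\mathbb{R}^n:T(y)\ge C\}$. If $e_+,e_-\in\mathfrak{M}$ and $R\hat\beta(e_+)=R\hat\beta(e_-)=0$, then for every $0<C<\infty$ (in items 1–3): 1. $\sup_{\mu_0\in\mathfrak{M}_0}\sup_{0<\sigma^2<\infty}\sup_{-1<\rho<1}P_{\mu_0,\sigma^2\Lambda(\rho)}(W(C))<1$, i.e. the size of $W(C)$ is strictly less than $1$. Furthermore, $\inf_{\mu_0\in\mathfrak{M}_0}\inf_{0<\sigma^2<\infty}\inf_{-1<\rho<1}P_{\mu_0,\sigma^2\Lambda(\rho)}(W(C))>0$. 2. The infimal power is bounded away from zero: $\inf_{\mu_1\in\mathfrak{M}_1}\inf_{0<\sigma^2<\infty}\inf_{-1<\rho<1}P_{\mu_1,\sigma^2\Lambda(\rho)}(W(C))>0$. 3. For every $0<c<\infty$ and every sequence $\rho_m\in(-1,1)$ with $|\rho_m|\to1$, $$\inf_{\mu_1\in\mathfrak{M}_1,\ 0<\sigma^2<\infty,\ d(\mu_1,\mathfrak{M}_0)/\sigma\ge c}P_{\mu_1,\sigma^2\Lambda(\rho_m)}(W(C))\to1\quad(m\to\infty).$$ Furthermore, for every sequence $0<c_m<\infty$ and every $0<\varepsilon<1$, $$\inf_{\mu_1\in\mathfrak{M}_1,\ d(\mu_1,\mathfrak{M}_0)\ge c_m}\ \inf_{-1+\varepsilon\le\rho\le1-\varepsilon}P_{\mu_1,\sigma_m^2\Lambda(\rho)}(W(C))\to1\quad(m\to\infty)$$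 whenever $0<\sigma_m^2<\infty$ and $c_m/\sigma_m\to\infty$. (This very last statement holds even without the conditions $e_+,e_-\in\mathfrak{M}$ and $R\hat\beta(e_+)=R\hat\beta(e_-)=0$.) 4. For every $0<\delta<1$ there exists $C(\delta)$, $0<C(\delta)<\infty$, such that $\sup_{\mu_0\in\mathfrak{M}_0}\sup_{0<\sigma^2<\infty}\sup_{-1<\rho<1}P_{\mu_0,\sigma^2\Lambda(\rho)}(W(C(\delta)))\le\delta$.
   Context: Framework: $n,k,q$ are integers with $1\le k<n$, $q\ge1$; $X$ is a fixed real $n\times k$ matrix of rank $k$; $R$ is a fixed real $q\times k$ matrix of rank $q$; $r\in\mathbb{R}^q$. $\mathfrak{M}=\operatorname{span}(X)$, $\mathfrak{M}_0=\{X\beta:\beta\in\mathbb{R}^k,\ R\beta=r\}$, $\mathfrak{M}_1=\mathfrak{M}\setminus\mathfrak{M}_0$. $P_{\mu,\Phi}$ is the Gaussian measure on $\mathbb{R}^n$ with mean $\mu$ and covariance matrix $\Phi$. $\mathfrak{C}$ is the covariance model: the set of matrices $\Sigma$ such that the observation may be distributed as $P_{\mu,\sigma^2\Sigma}$, with null hypothesis $\mu\in\mathfrak{M}_0$ and alternative $\mu\in\mathfrak{M}_1$ ($\sigma^2\in(0,\infty)$, $\Sigma\in\mathfrak{C}$ being nuisance parameters). $\hat\beta(y)=(X'X)^{-1}X'y$; $d(x,A)$ is the Euclidean distance from $x$ to $A$; $\sigma,\sigma_m$ denote positive square roots. $\Lambda(\rho)$ is the $n\times n$ matrix with $(i,j)$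 entry $\rho^{|i-j|}$; $\mathfrak{C}_{AR(1)}=\{\Lambda(\rho):\rho\in(-1,1)\}$. $e_+=(1,\dots,1)'$, $e_-=(-1,1,\dots,(-1)^n)'$ in $\mathbb{R}^n$; $e_i(n)$ is the $i$-th standard basis vector. Test statistic: the weights $w(j,n)$, $j=-(n-1),\dots,n-1$, are data-independent reals; admissible means $w(0,n)=1$, $w(-j,n)=w(j,n)$, and the Toeplitz matrix $(w(i-j,n))_{i,j=1}^n$ is positive definite. $\hat u(y)=y-X\hat\beta(y)$ with coordinates $\hat u_t(y)$, $x_{t\cdot}$ the $t$-th row of $X$, $\hat v_t(y)=\hat u_t(y)x_{t\cdot}'$, $\hat\Gamma_j(y)=n^{-1}\sum_{t=j+1}^n\hat v_t(y)\hat v_{t-j}(y)'$ for $j\ge0$, $\hat\Gamma_j(y)=\hat\Gamma_{-j}(y)'$ for $j<0$, $\hat\Psi_w(y)=\sum_{j=-(n-1)}^{n-1}w(j,n)\hat\Gamma_j(y)$, $\hat\Omega_w(y)=nR(X'X)^{-1}\hat\Psi_w(y)(X'X)^{-1}R'$. $T(y)=(R\hat\beta(y)-r)'\hat\Omega_w^{-1}(y)(R\hat\beta(y)-r)$ if $\det\hat\Omega_w(y)\ne0$ and $T(y)=0$ otherwise. Rank condition on $(X,R)$: let $i_1<\dots<i_s$ be all indices $i$ with $e_i(n)\in\operatorname{span}(X)$ ($s=0$ if there are none) and let $X'(\neg(i_1,\dots,i_s))$ be $X'$ with the columns with these indices deleted; then $\operatorname{rank}(R(X'X)^{-1}X'(\neg(i_1,\dots,i_s)))=q$.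 *)

theory Defs
  imports "HOL-Analysis.Analysis"
begin

text \<open>
  \<open>\<real>\<^sup>n\<close> is rendered as \<^typ>\<open>real^'n\<close> with a linearly ordered finite index type: the time index
  of a coordinate is its position \<open>1, \<dots>, n\<close> in that order.
\<close>

definition pos :: "'n::{finite,linorder} \<Rightarrow> nat" where
  "pos i = card {j. j \<le> i}"

definition at_pos :: "nat \<Rightarrow> 'n::{finite,linorder}" where
  "at_pos t = inv pos t"

lemma strict_mono_pos: "strict_mono (pos :: 'n::{finite,linorder} \<Rightarrow> nat)"
proof (rule strict_monoI)
  fix i j :: 'n
  assume "i < j"
  then have "{k. k \<le> i} \<subset> {k. k \<le> j}"
    by (auto simp: psubset_eq set_eq_iff intro: exI[of _ j])
  then show "pos i < pos j"
    unfolding pos_def by (intro psubset_card_mono) auto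
qed

lemma bij_betw_pos: "bij_betw (pos :: 'n::{finite,linorder} \<Rightarrow> nat) UNIV {1..CARD('n)}"
proof -
  have inj: "inj (pos :: 'n \<Rightarrow> nat)"
    using strict_mono_pos by (rule strict_mono_imp_inj_on)
  have sub: "range (pos :: 'n \<Rightarrow> nat) \<subseteq> {1..CARD('n)}"
  proof clarsimp
    fix i :: 'n
    have "card {i} \<le> pos i"
      unfolding pos_def by (rule card_mono) auto
    then show "Suc 0 \<le> pos i \<and> pos i \<le> CARD('n)"
      by (auto simp: pos_def intro: card_mono)
  qed
  have "range (pos :: 'n \<Rightarrow> nat) = {1..CARD('n)}"
    by (rule card_subset_eq[OF _ sub]) (simp_all add: card_image[OF inj])
  with inj show ?thesis by (simp add: bij_betw_def)
qed

lemma at_pos_pos [simp]: "at_pos (pos i) = i"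
  by (simp add: at_pos_def inv_f_f[OF strict_mono_imp_inj_on[OF strict_mono_pos]])

lemma pos_at_pos: "1 \<le> t \<Longrightarrow> t \<le> CARD('n) \<Longrightarrow> pos (at_pos t :: 'n::{finite,linorder}) = t"
  using bij_betw_pos[where 'n='n] by (simp add: at_pos_def bij_betw_def f_inv_into_f)

definition e_plus :: "real^'n::{finite,linorder}" where
  "e_plus = (\<chi> i. 1)"

definition e_minus :: "real^'n::{finite,linorder}" where
  "e_minus = (\<chi> i. (-1) ^ pos i)"

definition AR1_matrix :: "real \<Rightarrow> real^'n::{finite,linorder}^'n::{finite,linorder}" where
  "AR1_matrix \<rho> = (\<chi> i j. \<rho> ^ nat \<bar>int (pos i) - int (pos j)\<bar>)"

definition positive_definite :: "real^'n^'n \<Rightarrow> bool" where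
  "positive_definite A \<longleftrightarrow> transpose A = A \<and> (\<forall>x. x \<noteq> 0 \<longrightarrow> 0 < x \<bullet> (A *v x))"

text \<open>
  Given by its Lebesgue density, hence meaningful for positive definite \<open>\<Phi>\<close> only; the matrices
  \<open>\<sigma>\<^sup>2 \<Lambda>(\<rho>)\<close> with \<open>\<sigma>\<^sup>2 > 0\<close> and \<open>\<bar>\<rho>\<bar> < 1\<close> are of this kind.
\<close>

definition gaussian :: "real^'n \<Rightarrow> real^'n^'n \<Rightarrow> (real^'n) measure" where
  "gaussian \<mu> \<Phi> = density lborel (\<lambda>x. ennreal
     (exp (- ((x - \<mu>) \<bullet> (matrix_inv \<Phi> *v (x - \<mu>))) / 2) / sqrt ((2 * pi) ^ CARD('n) * det \<Phi>)))"

definition mspan :: "real^'k^'n \<Rightarrow> (real^'n) set" where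
  "mspan X = span (columns X)"

definition mspan0 :: "real^'k^'n \<Rightarrow> real^'k^'q \<Rightarrow> real^'q \<Rightarrow> (real^'n) set" where
  "mspan0 X R r = {X *v \<beta> | \<beta>. R *v \<beta> = r}"

definition mspan1 :: "real^'k^'n \<Rightarrow> real^'k^'q \<Rightarrow> real^'q \<Rightarrow> (real^'n) set" where
  "mspan1 X R r = mspan X - mspan0 X R r"

definition beta_hat :: "real^'k^'n \<Rightarrow> real^'n \<Rightarrow> real^'k" where
  "beta_hat X y = matrix_inv (transpose X ** X) *v (transpose X *v y)"

definition u_hat :: "real^'k^'n \<Rightarrow> real^'n \<Rightarrow> real^'n" where
  "u_hat X y = y - X *v beta_hat X y"

definition v_hat :: "real^'k^'n \<Rightarrow> real^'n \<Rightarrow> 'n \<Rightarrow> real^'k" where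
  "v_hat X y t = (u_hat X y $ t) *\<^sub>R row t X"

definition outer :: "real^'k \<Rightarrow> real^'k \<Rightarrow> real^'k^'k" where
  "outer a b = (\<chi> i j. a $ i * b $ j)"

definition Gamma_nat :: "real^'k^'n::{finite,linorder} \<Rightarrow> real^'n::{finite,linorder} \<Rightarrow> nat \<Rightarrow> real^'k^'k" where
  "Gamma_nat X y j = (1 / real CARD('n)) *\<^sub>R
     (\<Sum>t = j + 1..CARD('n). outer (v_hat X y (at_pos t)) (v_hat X y (at_pos (t - j))))"

definition Gamma_hat :: "real^'k^'n::{finite,linorder} \<Rightarrow> real^'n::{finite,linorder} \<Rightarrow> int \<Rightarrow> real^'k^'k" where
  "Gamma_hat X y j =
     (if 0 \<le> j then Gamma_nat X y (nat j) else transpose (Gamma_nat X y (nat (- j))))"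

definition Psi_hat ::
  "(int \<Rightarrow> real) \<Rightarrow> real^'k^'n::{finite,linorder} \<Rightarrow> real^'n::{finite,linorder} \<Rightarrow> real^'k^'k" where
  "Psi_hat w X y = (\<Sum>j = - (int CARD('n) - 1)..int CARD('n) - 1. w j *\<^sub>R Gamma_hat X y j)"

definition Omega_hat ::
  "(int \<Rightarrow> real) \<Rightarrow> real^'k^'n::{finite,linorder} \<Rightarrow> real^'k^'q \<Rightarrow> real^'n::{finite,linorder} \<Rightarrow> real^'q^'q" where
  "Omega_hat w X R y = real CARD('n) *\<^sub>R
     (R ** matrix_inv (transpose X ** X) ** Psi_hat w X y ** matrix_inv (transpose X ** X)
        ** transpose R)"

definition test_stat ::
  "(int \<Rightarrow> real) \<Rightarrow> real^'k^'n::{finite,linorder} \<Rightarrow> real^'k^'q \<Rightarrow> real^'q \<Rightarrow> real^'n::{finite,linorder} \<Rightarrow> real" where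
  "test_stat w X R r y =
     (if det (Omega_hat w X R y) \<noteq> 0
      then (R *v beta_hat X y - r) \<bullet> (matrix_inv (Omega_hat w X R y) *v (R *v beta_hat X y - r))
      else 0)"

definition rejection_region ::
  "(int \<Rightarrow> real) \<Rightarrow> real^'k^'n::{finite,linorder} \<Rightarrow> real^'k^'q \<Rightarrow> real^'q \<Rightarrow> real
     \<Rightarrow> (real^'n::{finite,linorder}) set" where
  "rejection_region w X R r C = {y. C \<le> test_stat w X R r y}"

text \<open>
  The sample size \<open>n\<close> is fixed, so \<open>w j\<close> stands for \<open>w(j, n)\<close>; only lags \<open>\<bar>j\<bar> < n\<close> are ever used.
  The type argument passes \<open>n\<close>.
\<close>

definition admissible_weights :: "'n::{finite,linorder} itself \<Rightarrow> (int \<Rightarrow> real) \<Rightarrow> bool" where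
  "admissible_weights _ w \<longleftrightarrow>
     w 0 = 1 \<and>
     (\<forall>j. \<bar>j\<bar> < int CARD('n) \<longrightarrow> w (- j) = w j) \<and>
     positive_definite ((\<chi> i j. w (int (pos i) - int (pos j))) :: real^'n::{finite,linorder}^'n::{finite,linorder})"

text \<open>
  The rank of the matrix with columns deleted is taken as its column rank, i.e. the dimension
  spanned by the columns that are kept.  Deleting columns of \<open>X'\<close> before multiplying by
  \<open>R (X'X)\<^sup>-\<^sup>1\<close> deletes the same columns of the product.
\<close>

definition rank_condition :: "real^'k^'n \<Rightarrow> real^'k^'q \<Rightarrow> bool" where
  "rank_condition X R \<longleftrightarrow>
     dim {column i (R ** matrix_inv (transpose X ** X) ** transpose X) | i.
            axis i 1 \<notin> mspan X} = CARD('q)"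

end

theory Submission
  imports Defs "HOL-Probability.Distributions"
begin

text \<open>
  Write the observation as \<open>X \<beta> + \<sigma> L z\<close> with \<open>z\<close> standard Gaussian and \<open>L L' = \<Lambda>(\<rho>)\<close>.  The test
  statistic only sees residuals and \<open>R \<beta>_hat - r\<close>, so it is equivariant: its value at this point is
  the statistic at \<open>L z\<close> for the restriction vector \<open>(r - R \<beta>) / \<sigma>\<close>, which vanishes under the null
  hypothesis (\<open>test_stat_transform\<close>, \<open>measure_rejection_region\<close>).  Everything is thus about the
  probabilities that \<open>T_v (A z) \<ge> C\<close> for a vector \<open>v\<close> and a matrix \<open>A\<close>.

  The only danger is that \<open>\<Lambda>(\<rho>)\<close> degenerates as \<open>\<rho>\<close> tends to 1 or -1.  It does so along \<open>e_plus\<close>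
  or \<open>e_minus\<close>: with \<open>\<tau> = sqrt (1 - \<rho>\<^sup>2)\<close> one has \<open>L z = c e + \<tau> A z\<close>, where \<open>e\<close> is the vector of
  powers of the sign of \<open>\<rho>\<close> and \<open>A\<close> is lower triangular with unit diagonal and entries bounded
  independently of \<open>\<rho>\<close> (\<open>AR1_factor_decomp\<close>, \<open>AR1_core_controlled\<close>).  If \<open>e\<close> lies in the span of
  \<open>X\<close> and \<open>R \<beta>_hat(e) = 0\<close>, equivariance removes \<open>c e\<close> and turns \<open>v\<close> into \<open>v / \<tau>\<close>.  So all
  \<open>\<rho>\<close> lead to matrices \<open>A\<close> in one family with bounded entries and determinant bounded away
  from zero, and near the unit root the deviation from the null is even magnified by \<open>1 / \<tau>\<close>.

  Over such a family the densities of \<open>A z\<close> are squeezed between multiples of two fixed centred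
  Gaussian densities.  Hence a Borel set that is not Lebesgue null has probability bounded away
  from zero (\<open>measure_gaussian_controlled_ge\<close>), and Borel sets decreasing to the empty set have
  uniformly vanishing probability (\<open>measure_gaussian_controlled_tendsto_0\<close>).  The claims follow from
  these properties of \<open>T\<close>:
  \<^item> the rank condition makes the covariance estimator invertible off finitely many hyperplanes
    (\<open>negligible_singular\<close>);
  \<^item> stretching the fitted part of \<open>y\<close> by \<open>s\<close> multiplies \<open>T_0\<close> by \<open>s\<^sup>2\<close>, so neither \<open>T_0 < C\<close> nor
    \<open>T_0 \<ge> C\<close> is a null event (\<open>not_null_below\<close>, \<open>not_null_above\<close>); this bounds the size away from 1
    and the null rejection probability away from 0;
  \<^item> by the parallelogram law \<open>T_0(y) \<ge> C\<close> forces \<open>T_v(y) \<ge> C\<close> or \<open>T_v(-y) \<ge> C\<close>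
    (\<open>test_stat_reflection\<close>), so by symmetry the power is at least half of the null rejection
    probability, whatever \<open>v\<close>;
  \<^item> \<open>T_v(y) < C\<close> forces \<open>norm v\<close> to be at most a constant times \<open>norm y\<close>
    (\<open>test_stat_lower_bound\<close>), so the power tends to 1 as \<open>norm v\<close> grows;
  \<^item> \<open>T_0\<close> is finite, so large critical values give small size.

  For \<open>\<rho>\<close> bounded away from 1 and -1 the factors \<open>L\<close> themselves lie in such a family; the last
  claim uses them in place of the matrices \<open>A\<close>.
\<close>

section \<open>Linear changes of variables for Lebesgue measure\<close>

lemma sum_Basis_component: "(\<Sum>b\<in>Basis. f b *\<^sub>R b) $ i = f (axis i (1::real) :: real^'n)"
  by (simp add: sum.reindex inj_on_def cart_eq_inner_axis inner_sum_left if_distrib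
         inner_Basis cong: if_cong)

text \<open>
  Fubini: for fixed other coordinates, a shear is a translation of one coordinate.
\<close>
lemma nn_integral_lborel_shear:
  fixes h :: "real^'n \<Rightarrow> ennreal"
  assumes [measurable]: "h \<in> borel_measurable borel" and mn: "m \<noteq> n"
  shows "(\<integral>\<^sup>+x. h (\<chi> i. if i = m then x$m + x$n else x$i) \<partial>lborel) = (\<integral>\<^sup>+x. h x \<partial>lborel)"
proof -
  let ?m = "axis m 1 :: real^'n" and ?n = "axis n 1 :: real^'n"
  define B where "B = (Basis :: (real^'n) set) - {?m}"
  have mB: "?m \<in> Basis" "?n \<in> B" "?n \<noteq> ?m" "?m \<notin> B" "finite B"
    using mn by (auto simp: B_def axis_eq_axis)
  have Bas: "Basis = insert ?m B"
    using mB by (auto simp: B_def)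
  let ?v = "\<lambda>f :: real^'n \<Rightarrow> real. \<Sum>b\<in>Basis. f b *\<^sub>R b"
  interpret product_sigma_finite "\<lambda>b::real^'n. lborel :: real measure" ..
  have sh: "(\<chi> i. if i = m then ?v (y(?m := t))$m + ?v (y(?m := t))$n else ?v (y(?m := t))$i)
    = ?v (y(?m := y ?n + t))" for y t
    unfolding vec_eq_iff vec_lambda_beta sum_Basis_component using mn by (simp add: axis_eq_axis)
  have [measurable]: "(\<lambda>x::real^'n. \<chi> i. if i = m then x$m + x$n else x$i) \<in> borel_measurable borel"
  proof (rule borel_measurable_continuous_onI, rule continuous_on_vec_lambda)
    show "continuous_on UNIV (\<lambda>x::real^'n. if i = m then x$m + x$n else x$i)" for i
      by (cases "i = m") (auto intro!: continuous_intros)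
  qed
  have m2: "(\<lambda>f. g (?v f)) \<in> borel_measurable (Pi\<^sub>M (insert ?m B) (\<lambda>b. lborel))" 
    if [measurable]: "g \<in> borel_measurable borel" for g :: "real^'n \<Rightarrow> ennreal"
    unfolding Bas by measurable
  have "(\<integral>\<^sup>+x. h (\<chi> i. if i = m then x$m + x$n else x$i) \<partial>lborel) = 
     (\<integral>\<^sup>+f. h (\<chi> i. if i = m then ?v f$m + ?v f$n else ?v f$i) \<partial>Pi\<^sub>M (insert ?m B) (\<lambda>b. lborel))"
    unfolding Bas[symmetric] by (subst lborel_eq) (simp add: nn_integral_distr)
  also have "\<dots> = (\<integral>\<^sup>+y. \<integral>\<^sup>+t. h (?v (y(?m := y ?n + t))) \<partial>lborel \<partial>Pi\<^sub>M B (\<lambda>b. lborel))"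
    by (subst product_nn_integral_insert) (use mB m2 sh in \<open>simp_all add: m2[of "\<lambda>x. h (\<chi> i. if i = m then x$m + x$n else x$i)"]\<close>)
  also have "\<dots> = (\<integral>\<^sup>+y. \<integral>\<^sup>+t. h (?v (y(?m := t))) \<partial>lborel \<partial>Pi\<^sub>M B (\<lambda>b. lborel))"
  proof (rule nn_integral_cong)
    fix y
    have "(\<integral>\<^sup>+t. h (?v (y(?m := t))) \<partial>lborel) = (\<integral>\<^sup>+t. h (?v (y(?m := y ?n + t))) \<partial>lborel)"
      by (subst nn_integral_real_affine[where c=1 and t="y ?n"])
         (auto intro!: measurable_compose[OF _ assms(1)] borel_measurable_sum simp: fun_upd_def)
    then show "(\<integral>\<^sup>+t. h (?v (y(?m := y ?n + t))) \<partial>lborel) = (\<integral>\<^sup>+t. h (?v (y(?m := t))) \<partial>lborel)" ..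
  qed
  also have "\<dots> = (\<integral>\<^sup>+f. h (?v f) \<partial>Pi\<^sub>M (insert ?m B) (\<lambda>b. lborel))"
    by (subst product_nn_integral_insert) (use mB m2 in simp_all)
  also have "\<dots> = (\<integral>\<^sup>+x. h x \<partial>lborel)"
    unfolding Bas[symmetric] by (subst (2) lborel_eq) (simp add: nn_integral_distr)
  finally show ?thesis .
qed

lemma prod_Basis_vec:
  fixes g :: "real^'n \<Rightarrow> 'b::comm_monoid_mult"
  shows "prod g Basis = (\<Prod>i\<in>UNIV. g (axis i 1))"
proof -
  have "bij_betw (\<lambda>i. axis i 1) UNIV (Basis :: (real^'n) set)"
    by (auto simp: bij_betw_def inj_on_def axis_eq_axis Basis_vec_def)
  then show ?thesis
    by (rule prod.reindex_bij_betw[symmetric])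
qed

lemma nn_integral_lborel_permute:
  fixes h :: "real^'n \<Rightarrow> ennreal"
  assumes p: "p permutes UNIV" and [measurable]: "h \<in> borel_measurable borel"
  shows "(\<integral>\<^sup>+x. h (\<chi> i. x $ p i) \<partial>lborel) = (\<integral>\<^sup>+x. h x \<partial>lborel)"
proof -
  let ?f = "\<lambda>x::real^'n. \<chi> i. x $ p i"
  let ?g = "\<lambda>x::real^'n. \<chi> i. x $ inv p i"
  have [measurable]: "?f \<in> borel_measurable borel"
    by (intro borel_measurable_continuous_onI continuous_intros)
  have "lborel = distr lborel borel ?f"
  proof (rule lborel_eqI)
    fix l u :: "real^'n"
    assume lu: "\<And>b. b \<in> Basis \<Longrightarrow> l \<bullet> b \<le> u \<bullet> b"
    have le: "l $ i \<le> u $ i" for i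
      using lu[of "axis i 1"] by (simp add: inner_axis)
    have "?f -` box l u = box (?g l) (?g u)"
      using permutes_inverses[OF p] by (auto simp: mem_box_cart) metis+
    moreover have "(\<Prod>i\<in>UNIV. (u - l) $ i) = (\<Prod>i\<in>UNIV. (?g u - ?g l) $ i)"
      using prod.permute[OF permutes_inv[OF p], of "\<lambda>i. (u - l) $ i"] by (simp add: o_def)
    moreover have "emeasure lborel (box (?g l) (?g u)) = (\<Prod>b\<in>Basis. (?g u - ?g l) \<bullet> b)"
      by (rule emeasure_lborel_box) (auto simp: Basis_vec_def inner_axis le)
    ultimately show "emeasure (distr lborel borel ?f) (box l u) = (\<Prod>b\<in>Basis. (u - l) \<bullet> b)"
      by (simp add: emeasure_distr prod_Basis_vec inner_axis)
  qed simp
  then have "(\<integral>\<^sup>+x. h x \<partial>lborel) = (\<integral>\<^sup>+x. h x \<partial>distr lborel borel ?f)"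
    by (rule arg_cong[where f="\<lambda>M. integral\<^sup>N M h"])
  also have "\<dots> = (\<integral>\<^sup>+x. h (?f x) \<partial>lborel)"
    by (simp add: nn_integral_distr)
  finally show ?thesis ..
qed

lemma borel_measurable_linear:
  fixes f :: "'a::euclidean_space \<Rightarrow> 'b::real_normed_vector"
  shows "linear f \<Longrightarrow> f \<in> borel_measurable borel"
  by (simp add: borel_measurable_continuous_onI linear_continuous_on linear_conv_bounded_linear)

text \<open>
  The class of maps with this property is closed under composition, so it suffices to treat the
  elementary maps: diagonal maps, transpositions of coordinates and shears.  Singular factors only
  occur in products whose determinant vanishes.
\<close>
lemma nn_integral_lborel_linear:
  fixes f :: "real^'n \<Rightarrow> real^'n" and h :: "real^'n \<Rightarrow> ennreal"
  assumes "linear f" "det (matrix f) \<noteq> 0" "h \<in> borel_measurable borel"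
  shows "(\<integral>\<^sup>+x. h x \<partial>lborel) = ennreal \<bar>det (matrix f)\<bar> * (\<integral>\<^sup>+x. h (f x) \<partial>lborel)"
proof -
  have "det (matrix f) \<noteq> 0 \<longrightarrow> (\<forall>h \<in> borel_measurable borel.
     (\<integral>\<^sup>+x. h x \<partial>lborel) = ennreal \<bar>det (matrix f)\<bar> * (\<integral>\<^sup>+x. h (f x) \<partial>lborel))"
    using \<open>linear f\<close>
  proof (rule induct_linear_elementary; intro impI ballI)
    fix f g :: "real^'n \<Rightarrow> real^'n" and h :: "real^'n \<Rightarrow> ennreal"
    assume lin: "linear f" "linear g" and h[measurable]: "h \<in> borel_measurable borel"
      and det: "det (matrix (f \<circ> g)) \<noteq> 0"
      and f: "det (matrix f) \<noteq> 0 \<longrightarrow> (\<forall>h \<in> borel_measurable borel.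
        (\<integral>\<^sup>+x. h x \<partial>lborel) = ennreal \<bar>det (matrix f)\<bar> * (\<integral>\<^sup>+x. h (f x) \<partial>lborel))"
      and g: "det (matrix g) \<noteq> 0 \<longrightarrow> (\<forall>h \<in> borel_measurable borel.
        (\<integral>\<^sup>+x. h x \<partial>lborel) = ennreal \<bar>det (matrix g)\<bar> * (\<integral>\<^sup>+x. h (g x) \<partial>lborel))"
    have d: "det (matrix (f \<circ> g)) = det (matrix f) * det (matrix g)"
      by (simp add: matrix_compose lin det_mul)
    have [measurable]: "f \<in> borel_measurable borel"
      by (rule borel_measurable_linear) fact
    have "(\<integral>\<^sup>+x. h x \<partial>lborel) = ennreal \<bar>det (matrix f)\<bar> * (\<integral>\<^sup>+x. h (f x) \<partial>lborel)"
      using f det d h by (metis mult_zero_left)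
    also have "(\<integral>\<^sup>+x. h (f x) \<partial>lborel) = ennreal \<bar>det (matrix g)\<bar> * (\<integral>\<^sup>+x. h (f (g x)) \<partial>lborel)"
      by (rule g[rule_format]) (use det d in auto)
    finally show "(\<integral>\<^sup>+x. h x \<partial>lborel) = ennreal \<bar>det (matrix (f \<circ> g))\<bar> * (\<integral>\<^sup>+x. h ((f \<circ> g) x) \<partial>lborel)"
      by (simp add: d abs_mult ennreal_mult mult.assoc)
  next
    fix f :: "real^'n \<Rightarrow> real^'n" and i and h :: "real^'n \<Rightarrow> ennreal"
    assume "linear f" and 0: "\<And>x. f x $ i = 0" and det: "det (matrix f) \<noteq> 0"
    then have "surj f"
      using det_nz_iff_inj linear_injective_imp_surjective by blast
    then have "f x $ i = 1" if "f x = axis i 1" for x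
      using that by simp
    with \<open>surj f\<close> 0 show "(\<integral>\<^sup>+x. h x \<partial>lborel) = ennreal \<bar>det (matrix f)\<bar> * (\<integral>\<^sup>+x. h (f x) \<partial>lborel)"
      by (metis surjD zero_neq_one)
  next
    fix c :: "'n \<Rightarrow> real" and h :: "real^'n \<Rightarrow> ennreal"
    let ?f = "\<lambda>x::real^'n. \<chi> i. c i * x $ i"
    assume det: "det (matrix ?f) \<noteq> 0" and [measurable]: "h \<in> borel_measurable borel"
    have d: "det (matrix ?f) = prod c UNIV"
      by (subst det_diagonal) (auto simp: matrix_def axis_def)
    let ?c = "\<lambda>b::real^'n. (\<chi> i. c i) \<bullet> b"
    have f: "?f = (\<lambda>x. 0 + (\<Sum>j\<in>Basis. (?c j * (x \<bullet> j)) *\<^sub>R j))"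
      unfolding fun_eq_iff vec_eq_iff vector_add_component sum_Basis_component
      by (simp add: inner_axis)
    have "?c j \<noteq> 0" if "j \<in> Basis" for j
      using that det unfolding d by (auto simp: Basis_vec_def inner_axis)
    note L = lborel_affine_euclidean[of ?c 0, OF this, folded f]
    have "(\<integral>\<^sup>+x. h x \<partial>lborel) =
      (\<integral>\<^sup>+x. h x \<partial>density (distr lborel borel ?f) (\<lambda>_. (\<Prod>j\<in>Basis. \<bar>?c j\<bar>)))"
      by (rule arg_cong[where f="\<lambda>M. integral\<^sup>N M h"]) (rule L)
    also have "\<dots> = ennreal \<bar>det (matrix ?f)\<bar> * (\<integral>\<^sup>+x. h (?f x) \<partial>lborel)"
    proof -
      have [measurable]: "?f \<in> borel_measurable borel"
        by (intro borel_measurable_continuous_onI continuous_intros)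
      show ?thesis
        by (simp add: nn_integral_density nn_integral_distr nn_integral_cmult d abs_prod prod_Basis_vec inner_axis prod_ennreal)
    qed
    finally show "(\<integral>\<^sup>+x. h x \<partial>lborel) = ennreal \<bar>det (matrix ?f)\<bar> * (\<integral>\<^sup>+x. h (?f x) \<partial>lborel)" .
  next
    fix m n :: 'n and h :: "real^'n \<Rightarrow> ennreal"
    let ?f = "\<lambda>x::real^'n. \<chi> i. x $ Transposition.transpose m n i"
    assume mn: "m \<noteq> n" and h: "h \<in> borel_measurable borel"
    have "matrix ?f = (\<chi> i. (mat 1 :: real^'n^'n) $ Transposition.transpose m n i)"
      by (auto simp: matrix_def axis_def mat_def vec_eq_iff)
    then have "\<bar>det (matrix ?f)\<bar> = 1"
      by (simp add: det_permute_rows permutes_swap_id sign_swap_id mn)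
    then show "(\<integral>\<^sup>+x. h x \<partial>lborel) = ennreal \<bar>det (matrix ?f)\<bar> * (\<integral>\<^sup>+x. h (?f x) \<partial>lborel)"
      using nn_integral_lborel_permute[OF _ h, of "Transposition.transpose m n"]
      by (simp add: permutes_swap_id)
  next
    fix m n :: 'n and h :: "real^'n \<Rightarrow> ennreal"
    let ?f = "\<lambda>x::real^'n. \<chi> i. if i = m then x$m + x$n else x$i"
    assume mn: "m \<noteq> n" and h: "h \<in> borel_measurable borel"
    have "matrix ?f = (\<chi> k. if k = m then row m (mat 1) + 1 *s row n (mat 1) else row k (mat 1 :: real^'n^'n))"
      using mn by (auto simp: matrix_def axis_def mat_def vec_eq_iff row_def)
    then have "det (matrix ?f) = 1"
      using det_row_operation[OF mn, of "mat 1" 1] by simp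
    then show "(\<integral>\<^sup>+x. h x \<partial>lborel) = ennreal \<bar>det (matrix ?f)\<bar> * (\<integral>\<^sup>+x. h (?f x) \<partial>lborel)"
      using nn_integral_lborel_shear[OF h mn] by simp
  qed
  with assms show ?thesis
    by blast
qed

section \<open>Gaussian measures as linear images of the standard one\<close>

lemma matrix_inv_unique:
  fixes A B :: "real^'n^'n"
  assumes "A ** B = mat 1" "B ** A = mat 1"
  shows "matrix_inv A = B"
proof -
  have "A ** matrix_inv A = mat 1 \<and> matrix_inv A ** A = mat 1"
    unfolding matrix_inv_def by (rule someI[of _ B]) (use assms in simp)
  then show ?thesis
    by (metis assms(2) matrix_mul_assoc matrix_mul_lid matrix_mul_rid)
qed

lemma inner_matrix_vector_mult:
  fixes A :: "real^'n^'m"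
  shows "x \<bullet> (A *v y) = (transpose A *v x) \<bullet> y"
  by (simp add: dot_lmul_matrix)

lemma gaussian_standard:
  "gaussian (0::real^'n) (mat 1) =
     density lborel (\<lambda>x. ennreal (exp (- (norm x)\<^sup>2 / 2) / sqrt ((2 * pi) ^ CARD('n))))"
proof -
  have "matrix_inv (mat 1) = (mat 1 :: real^'n^'n)"
    by (rule matrix_inv_unique) simp_all
  then show ?thesis
    by (simp add: gaussian_def power2_norm_eq_inner)
qed

text \<open>
  The density is a product of one-dimensional standard normal densities.
\<close>
lemma prob_space_gaussian_standard: "prob_space (gaussian (0::real^'n) (mat 1))"
proof
  have dens: "ennreal (exp (- (norm x)\<^sup>2 / 2) / sqrt ((2 * pi) ^ CARD('n))) =
      (\<Prod>b\<in>Basis. ennreal (std_normal_density (x \<bullet> b)))" for x :: "real^'n"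
  proof -
    have "(norm x)\<^sup>2 = (\<Sum>i\<in>UNIV. (x $ i)\<^sup>2)"
      by (simp add: norm_vec_def L2_set_def sum_nonneg)
    then have "exp (- (norm x)\<^sup>2 / 2) = (\<Prod>i\<in>UNIV. exp (- (x $ i)\<^sup>2 / 2))"
      by (simp add: exp_sum[symmetric] sum_divide_distrib sum_negf)
    moreover have "sqrt ((2 * pi) ^ CARD('n)) = (\<Prod>i\<in>(UNIV::'n set). sqrt (2 * pi))"
      by (simp only: prod_constant card_UNIV real_sqrt_power)
    ultimately show ?thesis
      by (simp add: prod_ennreal prod_Basis_vec inner_axis std_normal_density_def prod_dividef prod.distrib)
  qed
  have "emeasure (gaussian (0::real^'n) (mat 1)) (space (gaussian (0::real^'n) (mat 1)))
      = (\<integral>\<^sup>+x. (\<Prod>b\<in>(Basis :: (real^'n) set). ennreal (std_normal_density (x \<bullet> b))) \<partial>lborel)"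
    unfolding gaussian_standard dens by (simp add: emeasure_density)
  also have "\<dots> = (\<Prod>b\<in>(Basis :: (real^'n) set). (\<integral>\<^sup>+t. ennreal (std_normal_density t) \<partial>lborel))"
    by (subst nn_integral_lborel_prod) simp_all
  also have "\<dots> = 1"
    by (simp add: nn_integral_eq_integral)
  finally show "emeasure (gaussian (0::real^'n) (mat 1)) (space (gaussian (0::real^'n) (mat 1))) = 1" .
qed

lemma sets_gaussian [simp, measurable_cong]: "sets (gaussian \<mu> \<Phi>) = sets borel"
  and space_gaussian [simp]: "space (gaussian \<mu> \<Phi>) = UNIV"
  by (simp_all add: gaussian_def)

text \<open>
  With \<open>\<Phi> = B B'\<close> the quadratic form in the exponent is the squared norm of \<open>B\<^sup>-\<^sup>1 (y - \<mu>)\<close> and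
  the normalising determinant is \<open>(det B)\<^sup>2\<close>.  Writing the inverse as a variable \<open>B'\<close> avoids
  \<^const>\<open>matrix_inv\<close>.
\<close>
lemma gaussian_eq_density:
  fixes B B' :: "real^'n^'n"
  assumes B': "B ** B' = mat 1" "B' ** B = mat 1"
  shows "gaussian \<mu> (B ** transpose B) = density lborel
    (\<lambda>y. ennreal (exp (- (norm (B' *v (y - \<mu>)))\<^sup>2 / 2) / (sqrt ((2 * pi) ^ CARD('n)) * \<bar>det B\<bar>)))"
proof -
  have T: "transpose B ** transpose B' = mat 1" "transpose B' ** transpose B = mat 1"
    using B' by (simp_all add: matrix_transpose_mul[symmetric])
  have "matrix_inv (B ** transpose B) = transpose B' ** B'"
  proof (rule matrix_inv_unique)
    have "B ** transpose B ** (transpose B' ** B') = B ** (transpose B ** transpose B') ** B'"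
      by (simp add: matrix_mul_assoc)
    then show "B ** transpose B ** (transpose B' ** B') = mat 1"
      by (simp add: T B')
    have "transpose B' ** B' ** (B ** transpose B) = transpose B' ** (B' ** B) ** transpose B"
      by (simp add: matrix_mul_assoc)
    then show "transpose B' ** B' ** (B ** transpose B) = mat 1"
      by (simp add: T B')
  qed
  then have "x \<bullet> (matrix_inv (B ** transpose B) *v x) = (norm (B' *v x))\<^sup>2" for x
    by (simp add: power2_norm_eq_inner inner_matrix_vector_mult inner_commute flip: matrix_vector_mul_assoc)
  moreover have "sqrt ((2 * pi) ^ CARD('n) * det (B ** transpose B)) = sqrt ((2 * pi) ^ CARD('n)) * \<bar>det B\<bar>"
    by (simp add: det_mul real_sqrt_mult)
  ultimately show ?thesis
    by (simp add: gaussian_def)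
qed

lemma borel_measurable_matrix_vector_mult [measurable]:
  "(\<lambda>x. A *v (x::real^'n)) \<in> borel_measurable borel"
  by (rule borel_measurable_linear) (rule matrix_vector_mul_linear)

lemma gaussian_eq_distr:
  fixes B :: "real^'n^'n"
  assumes "det B \<noteq> 0"
  shows "gaussian \<mu> (B ** transpose B) = distr (gaussian 0 (mat 1)) borel (\<lambda>z. \<mu> + B *v z)"
proof -
  obtain B' where B': "B ** B' = mat 1" "B' ** B = mat 1"
    using assms by (auto simp: invertible_det_nz[symmetric] invertible_def)
  show ?thesis
  proof (rule measure_eqI)
    fix A assume "A \<in> sets (gaussian \<mu> (B ** transpose B))"
    then have [measurable]: "A \<in> sets borel"
      by simp
    let ?k = "sqrt ((2 * pi) ^ CARD('n))"
    let ?d = "\<lambda>y. ennreal (exp (- (norm (B' *v (y - \<mu>)))\<^sup>2 / 2) / (?k * \<bar>det B\<bar>)) * indicator A y"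
    have [measurable]: "?d \<in> borel_measurable borel"
      by measurable
    have "emeasure (gaussian \<mu> (B ** transpose B)) A = (\<integral>\<^sup>+y. ?d y \<partial>lborel)"
      by (simp add: gaussian_eq_density[OF B'] emeasure_density)
    also have "\<dots> = (\<integral>\<^sup>+y. ?d y \<partial>distr lborel borel ((+) \<mu>))"
      by (simp add: lborel_distr_plus)
    also have "\<dots> = (\<integral>\<^sup>+y. ?d (\<mu> + y) \<partial>lborel)"
      by (subst nn_integral_distr) simp_all
    also have "\<dots> = ennreal \<bar>det B\<bar> * (\<integral>\<^sup>+z. ?d (\<mu> + B *v z) \<partial>lborel)"
      by (subst nn_integral_lborel_linear[where f="(*v) B"])
         (use assms in \<open>simp_all add: matrix_vector_mul_linear matrix_of_matrix_vector_mul\<close>)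
    also have "\<dots> = (\<integral>\<^sup>+z. ennreal \<bar>det B\<bar> * ?d (\<mu> + B *v z) \<partial>lborel)"
      by (subst nn_integral_cmult) simp_all
    also have "\<dots> = (\<integral>\<^sup>+z. ennreal (exp (- (norm z)\<^sup>2 / 2) / ?k) * indicator A (\<mu> + B *v z) \<partial>lborel)"
    proof (rule nn_integral_cong)
      fix z
      have "B' *v (\<mu> + B *v z - \<mu>) = z"
        by (simp add: matrix_vector_mul_assoc B')
      then show "ennreal \<bar>det B\<bar> * ?d (\<mu> + B *v z) =
        ennreal (exp (- (norm z)\<^sup>2 / 2) / ?k) * indicator A (\<mu> + B *v z)"
        using assms by (simp add: mult.assoc[symmetric] ennreal_mult[symmetric])
    qed
    also have "\<dots> = emeasure (distr (gaussian 0 (mat 1)) borel (\<lambda>z. \<mu> + B *v z)) A"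
      by (subst emeasure_distr) (auto simp: gaussian_standard emeasure_density indicator_def vimage_def
          intro!: nn_integral_cong)
    finally show "emeasure (gaussian \<mu> (B ** transpose B)) A =
      emeasure (distr (gaussian 0 (mat 1)) borel (\<lambda>z. \<mu> + B *v z)) A" .
  qed simp
qed

section \<open>Uniform bounds over families of covariance factors\<close>

lemma abs_det_le:
  fixes A :: "real^'n^'n"
  assumes "\<And>i j. \<bar>A $ i $ j\<bar> \<le> M"
  shows "\<bar>det A\<bar> \<le> fact CARD('n) * M ^ CARD('n)"
proof -
  have "\<bar>det A\<bar> \<le> (\<Sum>p | p permutes (UNIV::'n set). \<bar>of_int (sign p) * (\<Prod>i\<in>UNIV. A $ i $ p i)\<bar>)"
    unfolding det_def by (rule sum_abs)
  also have "\<dots> \<le> (\<Sum>p | p permutes (UNIV::'n set). M ^ CARD('n))"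
  proof (rule sum_mono)
    fix p :: "'n \<Rightarrow> 'n"
    have "(\<Prod>i\<in>UNIV. \<bar>A $ i $ p i\<bar>) \<le> (\<Prod>i\<in>(UNIV::'n set). M)"
      using assms by (intro prod_mono) simp
    then show "\<bar>of_int (sign p) * (\<Prod>i\<in>UNIV. A $ i $ p i)\<bar> \<le> M ^ CARD('n)"
      by (simp add: abs_mult abs_prod sign_def)
  qed
  also have "\<dots> = fact CARD('n) * M ^ CARD('n)"
    by (simp add: card_permutations)
  finally show ?thesis .
qed

text \<open>
  A compact family of invertible matrices, described by explicit constants; uniformity in the
  correlation \<open>\<rho>\<close> is always uniformity over such a family.
\<close>
definition controlled :: "real \<Rightarrow> real \<Rightarrow> (real^'n^'n) set" where
  "controlled M d = {A. (\<forall>i j. \<bar>A $ i $ j\<bar> \<le> M) \<and> d \<le> \<bar>det A\<bar>}"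

lemma controlled_norm_le:
  fixes A :: "real^'n^'n"
  assumes "A \<in> controlled M d"
  shows "norm (A *v x) \<le> real CARD('n) * real CARD('n) * M * norm x"
proof -
  have "norm (A *v x) \<le> onorm ((*v) A) * norm x"
    by (rule onorm) (rule matrix_vector_mul_bounded_linear)
  also have "onorm ((*v) A) \<le> real CARD('n) * real CARD('n) * M"
    using assms by (intro onorm_le_matrix_component) (auto simp: controlled_def)
  finally show ?thesis
    by (simp add: mult_right_mono)
qed

text \<open>
  Cramer's rule for a right-hand side of norm one: each numerator is a determinant with entries
  bounded by \<open>max M 1\<close>, each denominator is at least \<open>d\<close> in modulus.
\<close>
lemma controlled_solution_norm_le:
  fixes A :: "real^'n^'n"
  assumes A: "A \<in> controlled M d" and d: "0 < d" and y: "A *v x = y"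
  shows "norm x \<le> real CARD('n) * (fact CARD('n) * max M 1 ^ CARD('n) / d) * norm y"
proof (cases "y = 0")
  case True
  have "det A \<noteq> 0"
    using A d by (auto simp: controlled_def)
  then have "x = 0"
    using y True by (metis invertible_det_nz invertible_left_inverse matrix_left_invertible_ker)
  then show ?thesis
    using d by (simp add: True)
next
  case False
  define u where "u = y /\<^sub>R norm y"
  define v where "v = x /\<^sub>R norm y"
  have det: "det A \<noteq> 0" "d \<le> \<bar>det A\<bar>"
    using A d by (auto simp: controlled_def)
  have "A *v v = u"
    by (simp add: u_def v_def y matrix_vector_mult_scaleR)
  then have v: "v = (\<chi> k. det (\<chi> i j. if j = k then u $ i else A $ i $ j) / det A)"
    using cramer[OF det(1)] by blast
  have "\<bar>v $ k\<bar> \<le> fact CARD('n) * max M 1 ^ CARD('n) / d" for k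
  proof -
    have "\<bar>u $ i\<bar> \<le> 1" for i
      using component_le_norm_cart[of u i] False by (simp add: u_def)
    then have "\<bar>det (\<chi> i j. if j = k then u $ i else A $ i $ j)\<bar> \<le> fact CARD('n) * max M 1 ^ CARD('n)"
      using A by (intro abs_det_le) (auto simp: controlled_def le_max_iff_disj)
    then show ?thesis
      using det d by (subst v) (simp add: abs_divide frac_le)
  qed
  then have "norm v \<le> (\<Sum>k\<in>(UNIV::'n set). fact CARD('n) * max M 1 ^ CARD('n) / d)"
    by (intro order_trans[OF norm_le_l1_cart] sum_mono)
  moreover have "norm x = norm v * norm y"
    using False by (simp add: v_def)
  ultimately show ?thesis
    using mult_right_mono[of "norm v" "real CARD('n) * (fact CARD('n) * max M 1 ^ CARD('n) / d)" "norm y"]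
    by simp
qed

lemma controlled_inverse:
  fixes A :: "real^'n^'n"
  assumes "A \<in> controlled M d" "0 < d"
  obtains A' where "A ** A' = mat 1" "A' ** A = mat 1"
  using assms by (auto simp: controlled_def) 
    (metis abs_zero invertible_def invertible_det_nz linorder_not_le)

text \<open>
  Since \<open>norm (A\<^sup>-\<^sup>1 y) \<le> c norm y\<close> for all \<open>A\<close> in the family, all densities of \<open>A z\<close> dominate one
  positive function \<open>f\<close>; its integral over \<open>E\<close> is the common lower bound.
\<close>
lemma measure_gaussian_controlled_ge:
  fixes E :: "(real^'n) set"
  assumes E [measurable]: "E \<in> sets borel" and "E \<notin> null_sets lborel" and d: "0 < d"
  shows "\<exists>p>0. \<forall>A\<in>controlled M d. p \<le> measure (gaussian 0 (mat 1)) {z. A *v z \<in> E}"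
proof -
  interpret N: prob_space "gaussian (0::real^'n) (mat 1)"
    by (rule prob_space_gaussian_standard)
  define c where "c = real CARD('n) * (fact CARD('n) * max M 1 ^ CARD('n) / d)"
  define k where "k = sqrt ((2 * pi) ^ CARD('n)) * (fact CARD('n) * max M 1 ^ CARD('n))"
  have "k > 0"
    by (auto simp: k_def intro!: mult_pos_pos)
  let ?f = "\<lambda>y::real^'n. ennreal (exp (- (c * norm y)\<^sup>2 / 2) / k)"
  have "(\<integral>\<^sup>+y. ?f y * indicator E y \<partial>lborel) \<noteq> 0"
  proof
    assume "(\<integral>\<^sup>+y. ?f y * indicator E y \<partial>lborel) = 0"
    then have "AE y in lborel. ?f y * indicator E y = 0"
      by (subst (asm) nn_integral_0_iff_AE) simp_all
    then have "AE y in lborel. y \<notin> E"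
      by eventually_elim (use \<open>k > 0\<close> in \<open>auto simp: indicator_def split: if_splits\<close>)
    then have "E \<in> null_sets lborel"
      by (subst (asm) AE_iff_null_sets[symmetric]) simp_all
    with assms show False by simp
  qed
  \<comment> \<open>Truncating at 1 spares a proof that the integral of the minorant is finite.\<close>
  moreover define m where "m = min 1 (\<integral>\<^sup>+y. ?f y * indicator E y \<partial>lborel)"
  ultimately have m: "0 < m" "m \<le> 1" "m \<le> (\<integral>\<^sup>+y. ?f y * indicator E y \<partial>lborel)"
    by (auto simp: min_def zero_less_iff_neq_zero)
  then have "m < top"
    using le_less_trans ennreal_one_less_top by blast
  define p where "p = enn2real m"
  have p: "0 < p" "ennreal p = m"
    using m \<open>m < top\<close> by (simp_all add: p_def enn2real_positive_iff)
  show ?thesis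
  proof (intro exI[of _ p] conjI ballI)
    fix A :: "real^'n^'n" assume A: "A \<in> controlled M d"
    then obtain A' where A': "A ** A' = mat 1" "A' ** A = mat 1"
      using d by (rule controlled_inverse)
    have det: "det A \<noteq> 0"
      using A d by (auto simp: controlled_def)
    have "ennreal p \<le> (\<integral>\<^sup>+y. ?f y * indicator E y \<partial>lborel)"
      using p m by simp
    also have "\<dots> \<le> emeasure (gaussian 0 (A ** transpose A)) E"
      unfolding gaussian_eq_density[OF A']
    proof (subst emeasure_density, measurable, rule nn_integral_mono, rule mult_right_mono, rule ennreal_leI)
      fix y
      have "norm (A' *v y) \<le> c * norm y"
        unfolding c_def by (rule controlled_solution_norm_le[OF A d]) (simp add: matrix_vector_mul_assoc A')
      then have "exp (- (c * norm y)\<^sup>2 / 2) \<le> exp (- (norm (A' *v (y - 0)))\<^sup>2 / 2)"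
        by (simp add: power_mono)
      moreover have "\<bar>det A\<bar> \<le> fact CARD('n) * max M 1 ^ CARD('n)"
        using A by (intro abs_det_le) (auto simp: controlled_def le_max_iff_disj)
      ultimately show "exp (- (c * norm y)\<^sup>2 / 2) / k
        \<le> exp (- (norm (A' *v (y - 0)))\<^sup>2 / 2) / (sqrt ((2 * pi) ^ CARD('n)) * \<bar>det A\<bar>)"
        using det unfolding k_def by (intro frac_le mult_left_mono) (auto intro!: mult_pos_pos)
    qed simp
    also have "\<dots> = emeasure (gaussian 0 (mat 1)) {z. A *v z \<in> E}"
      by (simp add: gaussian_eq_distr[OF det] emeasure_distr vimage_def)
    finally show "p \<le> measure (gaussian 0 (mat 1)) {z. A *v z \<in> E}"
      by (simp add: N.emeasure_eq_measure flip: p(2))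
  qed (rule p(1))
qed

text \<open>
  Since \<open>norm y \<le> c norm (A\<^sup>-\<^sup>1 y)\<close> for all \<open>A\<close> in the family, all densities of \<open>A z\<close> are bounded by
  one multiple of the density of \<open>c z\<close>, and the claim reduces to continuity from above of that
  single probability measure.
\<close>
lemma measure_gaussian_controlled_tendsto_0:
  fixes E :: "nat \<Rightarrow> (real^'n) set"
  assumes E [measurable]: "\<And>m. E m \<in> sets borel" and dec: "decseq E" and emp: "(\<Inter>m. E m) = {}"
    and d: "0 < d" and \<delta>: "0 < \<delta>"
  shows "\<exists>m. \<forall>A\<in>controlled M d. measure (gaussian 0 (mat 1)) {z. A *v z \<in> E m} \<le> \<delta>"
proof -
  interpret N: prob_space "gaussian (0::real^'n) (mat 1)"
    by (rule prob_space_gaussian_standard)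
  define c where "c = real CARD('n) * real CARD('n) * max M 1"
  have c: "0 < c"
    by (auto simp: c_def intro!: mult_pos_pos)
  let ?C = "c *\<^sub>R mat 1 :: real^'n^'n" and ?C' = "inverse c *\<^sub>R mat 1 :: real^'n^'n"
  have C': "?C ** ?C' = mat 1" "?C' ** ?C = mat 1"
    using c by (simp_all add: scalar_matrix_assoc[symmetric] matrix_scalar_ac)
  have detC: "det ?C = c ^ CARD('n)"
    by (subst det_diagonal) (simp_all add: mat_def)
  then have detC0: "det ?C \<noteq> 0"
    using c by simp
  define P where "P = gaussian (0::real^'n) (?C ** transpose ?C)"
  have "prob_space P"
    unfolding P_def gaussian_eq_distr[OF detC0] by (rule N.prob_space_distr) simp
  then interpret P: prob_space P .
  have sP [simp]: "sets P = sets borel"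
    by (simp add: P_def)
  have upper: "measure (gaussian 0 (mat 1)) {z. A *v z \<in> F} \<le> c ^ CARD('n) / d * measure P F"
    if A: "A \<in> controlled M d" and [measurable]: "F \<in> sets borel" for A F
  proof -
    obtain A' where A': "A ** A' = mat 1" "A' ** A = mat 1"
      using A d by (rule controlled_inverse)
    have det: "det A \<noteq> 0" "d \<le> \<bar>det A\<bar>"
      using A d by (auto simp: controlled_def)
    have "emeasure (gaussian 0 (mat 1)) {z. A *v z \<in> F} = emeasure (gaussian 0 (A ** transpose A)) F"
      by (simp add: gaussian_eq_distr[OF det(1)] emeasure_distr vimage_def)
    also have "\<dots> \<le> (\<integral>\<^sup>+y. ennreal (c ^ CARD('n) / d) *
       (ennreal (exp (- (norm (?C' *v (y - 0)))\<^sup>2 / 2) / (sqrt ((2 * pi) ^ CARD('n)) * \<bar>det ?C\<bar>)) * indicator F y) \<partial>lborel)"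
      unfolding gaussian_eq_density[OF A']
    proof (subst emeasure_density, measurable, rule nn_integral_mono)
      fix y
      have "norm y = norm (A *v (A' *v y))"
        by (simp add: matrix_vector_mul_assoc A')
      also have "\<dots> \<le> real CARD('n) * real CARD('n) * M * norm (A' *v y)"
        by (rule controlled_norm_le[OF A])
      also have "\<dots> \<le> c * norm (A' *v y)"
        by (auto simp: c_def intro!: mult_right_mono mult_left_mono)
      finally have "norm (?C' *v y) \<le> norm (A' *v y)"
        using c by (simp add: scaleR_matrix_vector_assoc[symmetric] divide_simps mult.commute)
      then have "exp (- (norm (A' *v (y - 0)))\<^sup>2 / 2) \<le> exp (- (norm (?C' *v (y - 0)))\<^sup>2 / 2)"
        by (simp add: power_mono)
      then have "exp (- (norm (A' *v (y - 0)))\<^sup>2 / 2) / (sqrt ((2 * pi) ^ CARD('n)) * \<bar>det A\<bar>)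
        \<le> exp (- (norm (?C' *v (y - 0)))\<^sup>2 / 2) / (sqrt ((2 * pi) ^ CARD('n)) * d)"
        using det d by (intro frac_le mult_left_mono) (auto intro!: mult_pos_pos)
      also have "\<dots> = c ^ CARD('n) / d * (exp (- (norm (?C' *v (y - 0)))\<^sup>2 / 2) / (sqrt ((2 * pi) ^ CARD('n)) * \<bar>det ?C\<bar>))"
        using c d by (simp add: detC)
      finally have le: "exp (- (norm (A' *v (y - 0)))\<^sup>2 / 2) / (sqrt ((2 * pi) ^ CARD('n)) * \<bar>det A\<bar>)
        \<le> c ^ CARD('n) / d * (exp (- (norm (?C' *v (y - 0)))\<^sup>2 / 2) / (sqrt ((2 * pi) ^ CARD('n)) * \<bar>det ?C\<bar>))" .
      show "ennreal (exp (- (norm (A' *v (y - 0)))\<^sup>2 / 2) / (sqrt ((2 * pi) ^ CARD('n)) * \<bar>det A\<bar>)) * indicator F y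
        \<le> ennreal (c ^ CARD('n) / d) *
       (ennreal (exp (- (norm (?C' *v (y - 0)))\<^sup>2 / 2) / (sqrt ((2 * pi) ^ CARD('n)) * \<bar>det ?C\<bar>)) * indicator F y)"
        unfolding mult.assoc[symmetric]
        by (rule mult_right_mono) (use le c d in \<open>simp_all add: ennreal_mult[symmetric] ennreal_leI\<close>)
    qed
    also have "\<dots> = ennreal (c ^ CARD('n) / d) * emeasure P F"
      unfolding P_def gaussian_eq_density[OF C']
      by (subst nn_integral_cmult) (simp_all add: emeasure_density)
    finally show ?thesis
      using c d by (simp add: N.emeasure_eq_measure P.emeasure_eq_measure ennreal_mult[symmetric])
  qed
  have "(\<lambda>m. measure P (E m)) \<longlonglongrightarrow> measure P (\<Inter>m. E m)"
    by (rule P.finite_Lim_measure_decseq) (auto simp: dec)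
  then have "(\<lambda>m. c ^ CARD('n) / d * measure P (E m)) \<longlonglongrightarrow> 0"
    unfolding emp measure_empty by (rule tendsto_mult_right_zero)
  then have "\<forall>\<^sub>F m in sequentially. c ^ CARD('n) / d * measure P (E m) < \<delta>"
    using \<delta> by (rule order_tendstoD)
  then obtain m where "c ^ CARD('n) / d * measure P (E m) < \<delta>"
    by (auto simp: eventually_sequentially)
  then show ?thesis
    using upper[OF _ E, of _ m] by (intro exI[of _ m]) force
qed

section \<open>Matrix algebra\<close>

text \<open>
  The simplifier would turn \<open>transpose A *v x\<close> into \<open>x v* A\<close>, which hides adjoints from the rules below.
\<close>
declare transpose_matrix_vector [simp del]

lemma inner_transpose:
  fixes A :: "real^'n^'m"
  shows "(transpose A *v x) \<bullet> y = x \<bullet> (A *v y)" and "y \<bullet> (transpose A *v x) = (A *v y) \<bullet> x"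
  using inner_matrix_vector_mult[of x A y] by (simp_all add: inner_commute)

lemma matrix_inv_mult_vector:
  fixes A :: "real^'n^'n"
  assumes "det A \<noteq> 0"
  shows "A *v (matrix_inv A *v b) = b" and "matrix_inv A *v (A *v b) = b"
proof -
  obtain A' where A': "A ** A' = mat 1" "A' ** A = mat 1"
    using assms by (auto simp: invertible_det_nz[symmetric] invertible_def)
  then have "matrix_inv A = A'"
    by (rule matrix_inv_unique)
  with A' show "A *v (matrix_inv A *v b) = b" and "matrix_inv A *v (A *v b) = b"
    by (simp_all add: matrix_vector_mul_assoc)
qed

lemma det_nonzero_if_ker_trivial:
  fixes A :: "real^'n^'n"
  assumes "\<And>x. A *v x = 0 \<Longrightarrow> x = 0"
  shows "det A \<noteq> 0"
  using assms by (metis invertible_det_nz invertible_left_inverse matrix_left_invertible_ker)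

lemma det_scaleR:
  fixes A :: "real^'n^'n"
  shows "det (c *\<^sub>R A) = c ^ CARD('n) * det A"
proof -
  have "c *\<^sub>R A = (\<chi> i. c *s (A $ i))"
    by (simp add: vec_eq_iff)
  then show ?thesis
    by (simp add: det_rows_mul)
qed

lemma matrix_eq_if_forms_eq:
  fixes A B :: "real^'n^'m"
  assumes "\<And>x a. x \<bullet> (A *v a) = x \<bullet> (B *v a)"
  shows "A = B"
proof -
  have "A *v a = B *v a" for a
    using assms by (intro vector_eq_ldot[THEN iffD1]) blast
  then show ?thesis
    by (simp add: matrix_eq)
qed

lemma borel_measurable_det:
  fixes A :: "'a \<Rightarrow> real^'n^'n"
  assumes [measurable]: "\<And>i j. (\<lambda>x. A x $ i $ j) \<in> borel_measurable M"
  shows "(\<lambda>x. det (A x)) \<in> borel_measurable M"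
  unfolding det_def by measurable

lemma negligible_linear_image:
  fixes f :: "'a::euclidean_space \<Rightarrow> 'a"
  shows "linear f \<Longrightarrow> negligible S \<Longrightarrow> negligible (f ` S)"
  by (rule negligible_differentiable_image_negligible) (auto simp: linear_imp_differentiable_on)

section \<open>The covariance estimator as a double sum\<close>

lemma pos_bounds: "1 \<le> pos (i :: 'n::{finite,linorder})" "pos (i :: 'n::{finite,linorder}) \<le> CARD('n)"
  using bij_betw_pos[where 'n='n] by (auto simp: bij_betw_def)

lemma Gamma_hat_eq:
  fixes X :: "real^'k^'n::{finite,linorder}"
  shows "Gamma_hat X y j = (1 / real CARD('n)) *\<^sub>R
    (\<Sum>(s, t) | int (pos s) - int (pos t) = j. outer (v_hat X y s) (v_hat X y t))"
proof -
  have nat: "Gamma_nat X y m = (1 / real CARD('n)) *\<^sub>R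
    (\<Sum>(s, t) | int (pos s) - int (pos t) = int m. outer (v_hat X y s) (v_hat X y t))" for m
  proof -
    have "(\<Sum>t = m + 1..CARD('n). outer (v_hat X y (at_pos t)) (v_hat X y (at_pos (t - m)))) =
      (\<Sum>(s, t) | int (pos s) - int (pos t) = int m. outer (v_hat X y s) (v_hat X y t))"
    proof (rule sum.reindex_bij_witness[where i="\<lambda>(s, t). pos s" and j="\<lambda>t. (at_pos t, at_pos (t - m))"])
      fix p :: "'n \<times> 'n"
      assume "p \<in> {(s, t). int (pos s) - int (pos t) = int m}"
      then obtain s t where p: "p = (s, t)" "int (pos s) - int (pos t) = int m"
        by auto
      then have "pos s - m = pos t"
        by linarith
      then show "(at_pos (case p of (s, t) \<Rightarrow> pos s), at_pos ((case p of (s, t) \<Rightarrow> pos s) - m)) = p"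
        by (simp add: p)
      show "(case p of (s, t) \<Rightarrow> pos s) \<in> {m + 1..CARD('n)}"
        using pos_bounds[of s] pos_bounds[of t] p by auto
    next
      fix t assume t: "t \<in> {m + 1..CARD('n)}"
      then have "pos (at_pos t :: 'n) = t" "pos (at_pos (t - m) :: 'n) = t - m"
        by (auto intro!: pos_at_pos)
      with t show "(case (at_pos t :: 'n, at_pos (t - m) :: 'n) of (s, t) \<Rightarrow> pos s) = t"
        and "(at_pos t :: 'n, at_pos (t - m) :: 'n) \<in> {(s, t). int (pos s) - int (pos t) = int m}"
        by auto
      show "(case (at_pos t :: 'n, at_pos (t - m) :: 'n) of (s, t) \<Rightarrow> outer (v_hat X y s) (v_hat X y t)) =
        outer (v_hat X y (at_pos t)) (v_hat X y (at_pos (t - m)))"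
        by simp
    qed
    then show ?thesis
      by (simp add: Gamma_nat_def)
  qed
  show ?thesis
  proof (cases "0 \<le> j")
    case True
    then show ?thesis
      by (simp add: Gamma_hat_def nat)
  next
    case False
    have tr: "transpose (outer a b) = outer b a" for a b :: "real^'k"
      by (simp add: transpose_def outer_def mult.commute)
    have ts: "transpose (sum f S) = (\<Sum>x\<in>S. transpose (f x))" for f :: "'n \<times> 'n \<Rightarrow> real^'k^'k" and S
      by (simp add: transpose_def vec_eq_iff)
    have "(\<Sum>(s, t) | int (pos s) - int (pos t) = - j. outer (v_hat X y t) (v_hat X y s))
      = (\<Sum>(s, t) | int (pos s) - int (pos t) = j. outer (v_hat X y s) (v_hat X y t))"
      by (rule sum.reindex_bij_witness[where i=prod.swap and j=prod.swap]) auto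
    then show ?thesis
      using False by (simp add: Gamma_hat_def nat transpose_scalar ts tr case_prod_unfold)
  qed
qed

text \<open>
  Grouping the pairs \<open>(s, t)\<close> by their lag \<open>s - t\<close> turns the sum of weighted autocovariances into one
  sum over all pairs of time points.
\<close>
lemma Psi_hat_eq:
  fixes X :: "real^'k^'n::{finite,linorder}"
  shows "Psi_hat w X y = (1 / real CARD('n)) *\<^sub>R
    (\<Sum>(s, t)\<in>UNIV. w (int (pos s) - int (pos t)) *\<^sub>R outer (v_hat X y s) (v_hat X y t))"
proof -
  let ?lag = "\<lambda>(s, t). int (pos (s::'n)) - int (pos (t::'n))"
  let ?h = "\<lambda>(s, t). w (int (pos s) - int (pos t)) *\<^sub>R outer (v_hat X y s) (v_hat X y t)"
  let ?J = "{- (int CARD('n) - 1)..int CARD('n) - 1}"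
  have "?lag p \<in> ?J" for p
    using pos_bounds[of "fst p"] pos_bounds[of "snd p"] by (auto simp: case_prod_unfold)
  then have sub: "range ?lag \<subseteq> ?J"
    by blast
  have "Psi_hat w X y = (1 / real CARD('n)) *\<^sub>R (\<Sum>j\<in>?J. \<Sum>p | p \<in> UNIV \<and> ?lag p = j. ?h p)"
    unfolding Psi_hat_def Gamma_hat_eq scaleR_sum_right
    by (intro sum.cong refl) (auto simp: case_prod_unfold)
  also have "(\<Sum>j\<in>?J. \<Sum>p | p \<in> UNIV \<and> ?lag p = j. ?h p) = (\<Sum>p\<in>UNIV. ?h p)"
    by (rule sum.group) (use sub in auto)
  finally show ?thesis .
qed

section \<open>The test statistic\<close>

locale regression =
  fixes X :: "real^'k^'n::{finite,linorder}"
    and R :: "real^'k^'q"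
    and w :: "int \<Rightarrow> real"
  assumes rank_X: "rank X = CARD('k)"
    and rank_R: "rank R = CARD('q)"
    and weights: "admissible_weights TYPE('n) w"
    and rank_XR: "rank_condition X R"
begin

definition Weights :: "((real, 'n) vec, 'n) vec" where
  "Weights = (\<chi> i j. w (int (pos i) - int (pos j)))"

lemma transpose_Weights: "transpose Weights = Weights"
  and Weights_pos: "x \<noteq> 0 \<Longrightarrow> 0 < x \<bullet> (Weights *v x)"
  using weights by (simp_all add: admissible_weights_def positive_definite_def Weights_def)

lemma Weights_nonneg: "0 \<le> x \<bullet> (Weights *v x)"
  using Weights_pos[of x] by (cases "x = 0") auto

definition XXinv :: "real^'k^'k" where
  "XXinv = matrix_inv (transpose X ** X)"

lemma inj_X: "inj ((*v) X)"
  using rank_X less_rank_noninjective[of X] by simp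

lemma det_XX: "det (transpose X ** X) \<noteq> 0"
proof (rule det_nonzero_if_ker_trivial)
  fix v assume "(transpose X ** X) *v v = 0"
  then have "v \<bullet> (transpose X *v (X *v v)) = 0"
    by (simp add: matrix_vector_mul_assoc)
  then have "X *v v = 0"
    by (simp add: inner_transpose)
  then show "v = 0"
    using inj_X by (metis injD matrix_vector_mult_0_right)
qed

lemma XXinv_XX: "XXinv *v (transpose X *v (X *v b)) = b"
  using matrix_inv_mult_vector(2)[OF det_XX, of b] by (simp add: XXinv_def matrix_vector_mul_assoc matrix_mul_assoc)

lemma XX_XXinv: "transpose X *v (X *v (XXinv *v b)) = b"
  using matrix_inv_mult_vector(1)[OF det_XX, of b] by (simp add: XXinv_def matrix_vector_mul_assoc matrix_mul_assoc)

lemma XXinv_symmetric: "a \<bullet> (XXinv *v b) = (XXinv *v a) \<bullet> b"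
proof -
  have "a \<bullet> (XXinv *v b) = (transpose X *v (X *v (XXinv *v a))) \<bullet> (XXinv *v b)"
    by (simp add: XX_XXinv)
  also have "\<dots> = (XXinv *v a) \<bullet> (transpose X *v (X *v (XXinv *v b)))"
    by (simp add: inner_transpose)
  finally show ?thesis
    by (simp add: XX_XXinv)
qed

lemma beta_hat_eq: "beta_hat X y = XXinv *v (transpose X *v y)"
  by (simp add: beta_hat_def XXinv_def)

lemma beta_hat_fitted [simp]: "beta_hat X (X *v b) = b"
  by (simp add: beta_hat_eq XXinv_XX)

lemma linear_beta_hat: "linear (beta_hat X)"
proof -
  have "beta_hat X = (*v) (XXinv ** transpose X)"
    by (simp add: fun_eq_iff beta_hat_eq matrix_vector_mul_assoc)
  then show ?thesis
    by (simp add: matrix_vector_mul_linear)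
qed

lemma linear_fitted: "linear (\<lambda>y. X *v beta_hat X y)"
  using linear_compose[OF linear_beta_hat matrix_vector_mul_linear[of X]] by (simp add: o_def)

lemma linear_u_hat: "linear (u_hat X)"
proof -
  have "u_hat X = (\<lambda>y. y - X *v beta_hat X y)"
    by (simp add: fun_eq_iff u_hat_def)
  then show ?thesis
    using linear_compose_sub[OF linear_ident linear_fitted] by simp
qed

lemma linear_stretch: "linear (\<lambda>z. u_hat X z + s *\<^sub>R (X *v beta_hat X z))"
  by (rule linear_compose_add[OF linear_u_hat linear_compose_scale_right[OF linear_fitted]])

lemmas beta_hat_simps [simp] = linear_add[OF linear_beta_hat] linear_diff[OF linear_beta_hat]
  linear_cmul[OF linear_beta_hat] linear_0[OF linear_beta_hat] linear_neg[OF linear_beta_hat]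

lemmas u_hat_simps [simp] = linear_add[OF linear_u_hat] linear_diff[OF linear_u_hat]
  linear_cmul[OF linear_u_hat] linear_0[OF linear_u_hat] linear_neg[OF linear_u_hat]

lemma u_hat_fitted [simp]: "u_hat X (X *v b) = 0"
  by (simp add: u_hat_def)

lemma beta_hat_u_hat [simp]: "beta_hat X (u_hat X y) = 0"
  by (simp add: u_hat_def)

lemma u_hat_idem [simp]: "u_hat X (u_hat X y) = u_hat X y"
  by (subst (2) u_hat_def) simp

lemma fitted_plus_u_hat: "u_hat X y + X *v beta_hat X y = y"
  by (simp add: u_hat_def)

lemma u_hat_symmetric: "x \<bullet> u_hat X y = u_hat X x \<bullet> y"
proof -
  have "x \<bullet> (X *v beta_hat X y) = (X *v beta_hat X x) \<bullet> y"
    by (simp only: beta_hat_eq inner_matrix_vector_mult[of x X] XXinv_symmetric inner_transpose(2))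
  then show ?thesis
    by (simp add: u_hat_def inner_diff_left inner_diff_right)
qed

lemma mspan_eq: "mspan X = range ((*v) X)"
proof
  have "column i X \<in> range ((*v) X)" for i
    by (metis matrix_vector_mult_basis rangeI)
  then have "columns X \<subseteq> range ((*v) X)"
    by (auto simp: columns_def)
  then show "mspan X \<subseteq> range ((*v) X)"
    unfolding mspan_def by (intro span_minimal linear_subspace_image matrix_vector_mul_linear) simp_all
  show "range ((*v) X) \<subseteq> mspan X"
    by (auto simp: mspan_def matrix_vector_mult_in_columnspace)
qed

text \<open>
  The vector through which the covariance estimator acts on \<open>a\<close>: with \<open>D\<close> the diagonal matrix of the
  residuals it is \<open>D X (X'X)\<^sup>-\<^sup>1 R' a\<close>.
\<close>
definition score :: "(real, 'n) vec \<Rightarrow> real^'q \<Rightarrow> (real, 'n) vec" where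
  "score y a = (\<chi> t. u_hat X y $ t * (X *v (XXinv *v (transpose R *v a))) $ t)"

text \<open>
  The estimator is \<open>B D W D B'\<close> with \<open>B = R (X'X)\<^sup>-\<^sup>1 X'\<close>, \<open>D\<close> the diagonal matrix of residuals and \<open>W\<close>
  the positive definite Toeplitz matrix of weights.  Symmetry, nonnegativity, scaling and the
  criterion for invertibility are all read off from this form.
\<close>
lemma Omega_hat_form:
  "x \<bullet> (Omega_hat w X R y *v a) = score y x \<bullet> (Weights *v score y a)"
proof -
  let ?c = "\<lambda>a. XXinv *v (transpose R *v a)"
  let ?F = "\<lambda>M. ?c x \<bullet> (M *v ?c a)"
  have lin: "linear ?F"
    by (rule linearI) (simp_all add: matrix_vector_mult_add_rdistrib inner_add_right scaleR_matrix_vector_assoc[symmetric])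
  have out: "?F (outer (v_hat X y s) (v_hat X y t)) = score y x $ s * score y a $ t" for s t
  proof -
    have "outer b d *v c = (d \<bullet> c) *\<^sub>R b" for b c d :: "real^'k"
      by (simp add: vec_eq_iff outer_def matrix_vector_mult_def inner_vec_def sum_distrib_left sum_distrib_right mult_ac)
    moreover have "v_hat X y t \<bullet> c = u_hat X y $ t * (X *v c) $ t" for t c
      by (simp add: v_hat_def matrix_vector_mult_def inner_vec_def row_def sum_distrib_left mult.assoc)
    ultimately show ?thesis
      using inner_commute[of "?c x" "v_hat X y s"] by (simp add: score_def)
  qed
  have "x \<bullet> (Omega_hat w X R y *v a) = real CARD('n) * ?F (Psi_hat w X y)"
    unfolding Omega_hat_def XXinv_def[symmetric]
    by (simp only: scaleR_matrix_vector_assoc[symmetric] matrix_vector_mul_assoc[symmetric] inner_scaleR_right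
        inner_matrix_vector_mult[of x R] XXinv_symmetric[of "transpose R *v x"])
  also have "\<dots> = (\<Sum>(s, t)\<in>UNIV. w (int (pos s) - int (pos t)) * (score y x $ s * score y a $ t))"
    unfolding Psi_hat_eq linear_cmul[OF lin] linear_sum[OF lin] case_prod_unfold out by simp
  also have "\<dots> = (\<Sum>s\<in>UNIV. \<Sum>t\<in>UNIV. w (int (pos s) - int (pos t)) * (score y x $ s * score y a $ t))"
    unfolding UNIV_Times_UNIV[symmetric] by (rule sum.cartesian_product[symmetric])
  also have "\<dots> = score y x \<bullet> (Weights *v score y a)"
    by (simp add: inner_vec_def matrix_vector_mult_def Weights_def sum_distrib_left mult_ac)
  finally show ?thesis .
qed

lemma Omega_hat_symmetric: "x \<bullet> (Omega_hat w X R y *v a) = a \<bullet> (Omega_hat w X R y *v x)"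
  unfolding Omega_hat_form inner_matrix_vector_mult[of "score y x"] transpose_Weights
  by (rule inner_commute)

lemma Omega_hat_nonneg: "0 \<le> a \<bullet> (Omega_hat w X R y *v a)"
  by (simp add: Omega_hat_form Weights_nonneg)

lemma Omega_hat_cong:
  "(\<And>a. score y a = c *\<^sub>R score z a) \<Longrightarrow> Omega_hat w X R y = c\<^sup>2 *\<^sub>R Omega_hat w X R z"
proof (rule matrix_eq_if_forms_eq)
  fix x a :: "real^'q"
  assume "\<And>a. score y a = c *\<^sub>R score z a"
  then show "x \<bullet> (Omega_hat w X R y *v a) = x \<bullet> ((c\<^sup>2 *\<^sub>R Omega_hat w X R z) *v a)"
    unfolding scaleR_matrix_vector_assoc[symmetric] inner_scaleR_right Omega_hat_form
    by (simp only: matrix_vector_mult_scaleR inner_scaleR_right inner_scaleR_left power2_eq_square mult.assoc)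
qed

lemma Omega_hat_bound: "\<exists>K>0. \<forall>y a. a \<bullet> (Omega_hat w X R y *v a) \<le> K * (norm y)\<^sup>2 * (norm a)\<^sup>2"
proof -
  obtain K1 where K1: "K1 > 0" "\<And>y. norm (u_hat X y) \<le> K1 * norm y"
    using linear_bounded_pos[OF linear_u_hat] by auto
  have "linear (\<lambda>a. X *v (XXinv *v (transpose R *v a)))"
    using matrix_vector_mul_linear[of "X ** XXinv ** transpose R"] by (simp flip: matrix_vector_mul_assoc)
  from linear_bounded_pos[OF this]
  obtain K2 where K2: "K2 > 0" "\<And>a. norm (X *v (XXinv *v (transpose R *v a))) \<le> K2 * norm a"
    by auto
  obtain K3 where K3: "K3 > 0" "\<And>a. norm (Weights *v a) \<le> K3 * norm a"
    using linear_bounded_pos[OF matrix_vector_mul_linear[of Weights]] by auto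
  have sc: "norm (score y a) \<le> real CARD('n) * (K1 * K2) * (norm y * norm a)" for y a
  proof -
    have "\<bar>score y a $ t\<bar> \<le> K1 * K2 * (norm y * norm a)" for t
    proof -
      have "\<bar>score y a $ t\<bar> \<le> (K1 * norm y) * (K2 * norm a)"
        unfolding score_def vec_lambda_beta abs_mult
        by (intro mult_mono order_trans[OF component_le_norm_cart] K1 K2) (use K1 in auto)
      then show ?thesis
        by (simp add: mult_ac)
    qed
    then have "norm (score y a) \<le> (\<Sum>t\<in>(UNIV::'n set). K1 * K2 * (norm y * norm a))"
      by (intro order_trans[OF norm_le_l1_cart] sum_mono)
    then show ?thesis
      by (simp add: mult_ac)
  qed
  show ?thesis
  proof (intro exI conjI allI)
    show "K3 * (real CARD('n) * (K1 * K2))\<^sup>2 > 0"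
      using K1 K2 K3 by simp
    fix y a
    have "a \<bullet> (Omega_hat w X R y *v a) \<le> norm (score y a) * (K3 * norm (score y a))"
      unfolding Omega_hat_form by (rule order_trans[OF norm_cauchy_schwarz mult_left_mono[OF K3(2)]]) simp
    also have "\<dots> = K3 * (norm (score y a))\<^sup>2"
      by (simp add: power2_eq_square)
    also have "\<dots> \<le> K3 * (real CARD('n) * (K1 * K2) * (norm y * norm a))\<^sup>2"
      using sc K3 by (intro mult_left_mono power_mono) auto
    finally show "a \<bullet> (Omega_hat w X R y *v a) \<le> K3 * (real CARD('n) * (K1 * K2))\<^sup>2 * (norm y)\<^sup>2 * (norm a)\<^sup>2"
      by (simp add: power_mult_distrib mult_ac)
  qed
qed

lemma test_stat_eq:
  assumes "det (Omega_hat w X R y) \<noteq> 0" and "Omega_hat w X R y *v x = R *v beta_hat X y - r"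
  shows "test_stat w X R r y = (R *v beta_hat X y - r) \<bullet> x"
  using assms matrix_inv_mult_vector(2)[OF assms(1), of x] by (simp add: test_stat_def)

lemma test_stat_solution:
  assumes "det (Omega_hat w X R y) \<noteq> 0"
  obtains x where "Omega_hat w X R y *v x = R *v beta_hat X y - r"
    and "test_stat w X R r y = x \<bullet> (Omega_hat w X R y *v x)"
proof -
  define x where "x = matrix_inv (Omega_hat w X R y) *v (R *v beta_hat X y - r)"
  have "Omega_hat w X R y *v x = R *v beta_hat X y - r"
    by (simp add: x_def matrix_inv_mult_vector(1)[OF assms])
  then show ?thesis
    using that test_stat_eq[OF assms] by (simp add: inner_commute)
qed

text \<open>
  Adding \<open>X b\<close> leaves the residuals alone, and scaling by \<open>s\<close> multiplies the estimator by \<open>s\<^sup>2\<close> and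
  the deviation \<open>R \<beta>_hat - r\<close>, up to the shift of \<open>r\<close>, by \<open>s\<close>; the factors cancel.
\<close>
lemma test_stat_transform:
  assumes s: "s \<noteq> 0"
  shows "test_stat w X R r (X *v b + s *\<^sub>R z) = test_stat w X R ((r - R *v b) /\<^sub>R s) z"
proof -
  have "score (X *v b + s *\<^sub>R z) a = s *\<^sub>R score z a" for a
    by (simp add: score_def vec_eq_iff)
  then have Om: "Omega_hat w X R (X *v b + s *\<^sub>R z) = s\<^sup>2 *\<^sub>R Omega_hat w X R z"
    by (rule Omega_hat_cong)
  show ?thesis
  proof (cases "det (Omega_hat w X R z) = 0")
    case True
    then show ?thesis
      by (simp add: test_stat_def Om det_scaleR)
  next
    case False
    then obtain x where x: "Omega_hat w X R z *v x = R *v beta_hat X z - (r - R *v b) /\<^sub>R s"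
      and T: "test_stat w X R ((r - R *v b) /\<^sub>R s) z = x \<bullet> (Omega_hat w X R z *v x)"
      by (rule test_stat_solution)
    have b: "R *v beta_hat X (X *v b + s *\<^sub>R z) - r = s *\<^sub>R (R *v beta_hat X z - (r - R *v b) /\<^sub>R s)"
      using s by (simp add: matrix_vector_right_distrib matrix_vector_mult_scaleR scaleR_diff_right)
    have "test_stat w X R r (X *v b + s *\<^sub>R z) = (R *v beta_hat X (X *v b + s *\<^sub>R z) - r) \<bullet> (x /\<^sub>R s)"
    proof (rule test_stat_eq)
      show "det (Omega_hat w X R (X *v b + s *\<^sub>R z)) \<noteq> 0"
        using s False by (simp add: Om det_scaleR)
      show "Omega_hat w X R (X *v b + s *\<^sub>R z) *v (x /\<^sub>R s) = R *v beta_hat X (X *v b + s *\<^sub>R z) - r"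
        unfolding b x[symmetric] Om using s
        by (simp add: scaleR_matrix_vector_assoc[symmetric] matrix_vector_mult_scaleR power2_eq_square)
    qed
    also have "\<dots> = x \<bullet> (Omega_hat w X R z *v x)"
      unfolding b x[symmetric] using s by (simp add: inner_commute)
    finally show ?thesis
      by (simp add: T)
  qed
qed

text \<open>
  Residuals, and hence the estimator, ignore the factor \<open>s\<close>, while \<open>\<beta>_hat\<close> is multiplied by it.
\<close>
lemma test_stat_stretch:
  "test_stat w X R 0 (u_hat X z + s *\<^sub>R (X *v beta_hat X z)) = s\<^sup>2 * test_stat w X R 0 z"
proof -
  let ?y = "u_hat X z + s *\<^sub>R (X *v beta_hat X z)"
  have "score ?y a = 1 *\<^sub>R score z a" for a
    by (simp add: score_def vec_eq_iff)
  then have Om: "Omega_hat w X R ?y = Omega_hat w X R z"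
    using Omega_hat_cong[of ?y 1 z] by simp
  show ?thesis
    by (simp add: test_stat_def Om matrix_vector_mult_scaleR power2_eq_square)
qed

lemma test_stat_nonneg: "0 \<le> test_stat w X R r y"
proof (cases "det (Omega_hat w X R y) = 0")
  case False
  then show ?thesis
    by (metis test_stat_solution Omega_hat_nonneg)
qed (simp add: test_stat_def)

text \<open>
  If \<open>b \<bullet> \<Omega> b \<le> k (norm b)\<^sup>2\<close>, then evaluating the nonnegative form of \<open>\<Omega>\<close> at
  \<open>\<Omega>\<^sup>-\<^sup>1 b - b / k\<close> gives \<open>b \<bullet> \<Omega>\<^sup>-\<^sup>1 b \<ge> (norm b)\<^sup>2 / k\<close>; here \<open>k\<close> is a multiple of \<open>(norm y)\<^sup>2\<close>.
\<close>
lemma test_stat_lower_bound: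
  "\<exists>K>0. \<forall>y r. det (Omega_hat w X R y) \<noteq> 0 \<longrightarrow>
     (norm (R *v beta_hat X y - r))\<^sup>2 \<le> K * (norm y)\<^sup>2 * test_stat w X R r y"
proof -
  obtain K where K: "K > 0" "\<And>y a. a \<bullet> (Omega_hat w X R y *v a) \<le> K * (norm y)\<^sup>2 * (norm a)\<^sup>2"
    using Omega_hat_bound by auto
  have "(norm (R *v beta_hat X y - r))\<^sup>2 \<le> K * (norm y)\<^sup>2 * test_stat w X R r y"
    if det: "det (Omega_hat w X R y) \<noteq> 0" for y r
  proof -
    let ?\<Omega> = "Omega_hat w X R y"
    define b where "b = R *v beta_hat X y - r"
    obtain x where x: "?\<Omega> *v x = b" and T: "test_stat w X R r y = x \<bullet> (?\<Omega> *v x)"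
      unfolding b_def using det by (rule test_stat_solution)
    have "y \<noteq> 0"
    proof
      assume "y = 0"
      then have "?\<Omega> = 0"
        by (intro matrix_eq_if_forms_eq) (simp add: Omega_hat_form score_def zero_vec_def[symmetric])
      then have "(1 :: real^'q) = 0"
        using matrix_inv_mult_vector(1)[OF det, of 1] by simp
      then show False
        by simp
    qed
    define k where "k = K * (norm y)\<^sup>2"
    have k: "k > 0"
      using K \<open>y \<noteq> 0\<close> by (simp add: k_def)
    have sym: "x \<bullet> (?\<Omega> *v b) = (norm b)\<^sup>2"
      unfolding Omega_hat_symmetric[of x y b] x power2_norm_eq_inner ..
    have "0 \<le> (x - b /\<^sub>R k) \<bullet> (?\<Omega> *v (x - b /\<^sub>R k))"
      by (rule Omega_hat_nonneg)
    also have "\<dots> = x \<bullet> (?\<Omega> *v x) - 2 * (norm b)\<^sup>2 / k + (b \<bullet> (?\<Omega> *v b)) / k\<^sup>2"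
    proof -
      have "b \<bullet> (?\<Omega> *v x) = (norm b)\<^sup>2"
        by (simp add: x power2_norm_eq_inner)
      then show ?thesis
        using sym by (simp add: matrix_vector_mult_diff_distrib matrix_vector_mult_scaleR inner_diff_left
            inner_diff_right inverse_eq_divide power2_eq_square diff_divide_distrib del: dot_square_norm)
    qed
    also have "(b \<bullet> (?\<Omega> *v b)) / k\<^sup>2 \<le> k * (norm b)\<^sup>2 / k\<^sup>2"
      using K(2)[of b y] unfolding k_def by (intro divide_right_mono) auto
    finally have "(norm b)\<^sup>2 / k \<le> test_stat w X R r y"
      using k by (simp add: T power2_eq_square divide_simps)
    then show ?thesis
      using k by (simp add: b_def[symmetric] k_def[symmetric] pos_divide_le_eq mult.commute)
  qed
  with K(1) show ?thesis
    by blast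
qed

text \<open>
  The estimator is the same at \<open>y\<close> and \<open>-y\<close>, and the two values of the statistic are the squared
  lengths of \<open>R \<beta>_hat - r\<close> and \<open>R \<beta>_hat + r\<close> in the norm of its inverse.  By the parallelogram law
  they add up to at least twice the squared length of \<open>R \<beta>_hat\<close>.
\<close>
lemma test_stat_reflection:
  assumes "0 < C" "C \<le> test_stat w X R 0 y"
  shows "C \<le> test_stat w X R r y \<or> C \<le> test_stat w X R r (- y)"
proof -
  let ?\<Omega> = "Omega_hat w X R y"
  have det: "det ?\<Omega> \<noteq> 0"
    using assms by (auto simp: test_stat_def split: if_splits)
  have refl: "test_stat w X R r (- y) = test_stat w X R (- r) y"
    using test_stat_transform[of "-1" r 0 y] by simp
  obtain p where p: "?\<Omega> *v p = R *v beta_hat X y" "test_stat w X R 0 y = p \<bullet> (?\<Omega> *v p)"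
    using test_stat_solution[OF det, of 0] by auto
  define d where "d = matrix_inv ?\<Omega> *v r"
  have d: "?\<Omega> *v d = r"
    by (simp add: d_def matrix_inv_mult_vector(1)[OF det])
  have "test_stat w X R r y = (?\<Omega> *v (p - d)) \<bullet> (p - d)"
    using test_stat_eq[OF det, of "p - d" r] by (simp add: matrix_vector_mult_diff_distrib p d)
  moreover have "test_stat w X R (- r) y = (?\<Omega> *v (p + d)) \<bullet> (p + d)"
    using test_stat_eq[OF det, of "p + d" "- r"] by (simp add: matrix_vector_right_distrib p d)
  ultimately have "test_stat w X R r y + test_stat w X R r (- y) = 2 * (p \<bullet> (?\<Omega> *v p)) + 2 * (d \<bullet> (?\<Omega> *v d))"
    unfolding refl by (simp add: matrix_vector_mult_diff_distrib matrix_vector_right_distrib inner_add_left inner_diff_left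
       inner_add_right inner_diff_right inner_commute)
  with Omega_hat_nonneg[of d y] assms p show ?thesis
    by linarith
qed

text \<open>
  A null vector \<open>a\<close> of the estimator has zero score because the weights are positive definite.  Where
  the residual is nonzero, this says that the corresponding column of \<open>R (X'X)\<^sup>-\<^sup>1 X'\<close> is orthogonal
  to \<open>a\<close>, and by the rank condition these columns span everything.
\<close>
lemma regular_if_residuals_nonzero:
  assumes u: "\<And>t. axis t 1 \<notin> mspan X \<Longrightarrow> u_hat X y $ t \<noteq> 0"
  shows "det (Omega_hat w X R y) \<noteq> 0"
proof (rule det_nonzero_if_ker_trivial)
  fix a assume "Omega_hat w X R y *v a = 0"
  then have "score y a \<bullet> (Weights *v score y a) = 0"
    by (simp add: Omega_hat_form[symmetric])
  then have sc: "score y a = 0"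
    using Weights_pos by force
  let ?B = "R ** matrix_inv (transpose X ** X) ** transpose X"
  let ?S = "{column t ?B | t. axis t 1 \<notin> mspan X}"
  have col: "column t ?B \<bullet> a = (X *v (XXinv *v (transpose R *v a))) $ t" for t
  proof -
    have "column t ?B = ?B *v axis t 1"
      by (simp add: matrix_vector_mult_basis)
    also have "\<dots> = R *v (XXinv *v (transpose X *v axis t 1))"
      by (simp add: XXinv_def flip: matrix_vector_mul_assoc)
    also have "\<dots> \<bullet> a = axis t 1 \<bullet> (X *v (XXinv *v (transpose R *v a)))"
      by (simp only: inner_matrix_vector_mult[of "axis t 1" X] XXinv_symmetric inner_transpose(2))
    finally show ?thesis
      by (simp add: inner_axis')
  qed
  have orth: "orthogonal a x" if mem: "x \<in> ?S" for x
  proof -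
    obtain t where t: "x = column t ?B" "axis t 1 \<notin> mspan X"
      using mem by blast
    have "score y a $ t = 0"
      by (simp add: sc)
    then show ?thesis
      using u[OF t(2)] col[of t] by (simp add: score_def t orthogonal_def inner_commute)
  qed
  have span: "span ?S = UNIV"
    using rank_XR by (simp add: rank_condition_def dim_eq_full[symmetric])
  have "orthogonal a a"
    by (rule orthogonal_to_span[where S="?S"]) (use span orth in auto)
  then show "a = 0"
    by (simp add: orthogonal_def)
qed

text \<open>
  If the \<open>t\<close>-th unit vector is outside the span of \<open>X\<close>, the \<open>t\<close>-th residual is a nonzero linear
  functional of \<open>y\<close>, whose zero set is a hyperplane.
\<close>
lemma negligible_singular: "negligible {y. det (Omega_hat w X R y) = 0}"
proof (rule negligible_subset)
  let ?I = "{t. axis t 1 \<notin> mspan X}"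
  show "negligible (\<Union>t\<in>?I. {y. u_hat X (axis t 1) \<bullet> y = 0})"
  proof (rule negligible_Union)
    fix S assume "S \<in> (\<lambda>t. {y. u_hat X (axis t 1) \<bullet> y = 0}) ` ?I"
    then obtain t where t: "axis t 1 \<notin> mspan X" "S = {y. u_hat X (axis t 1) \<bullet> y = 0}"
      by auto
    have "u_hat X (axis t 1) \<noteq> 0"
      using t(1) by (auto simp: mspan_eq u_hat_def)
    then show "negligible S"
      using t(2) negligible_hyperplane by blast
  qed simp
  show "{y. det (Omega_hat w X R y) = 0} \<subseteq> (\<Union>t\<in>?I. {y. u_hat X (axis t 1) \<bullet> y = 0})"
  proof
    fix y assume "y \<in> {y. det (Omega_hat w X R y) = 0}"
    then obtain t where "axis t 1 \<notin> mspan X" "u_hat X y $ t = 0"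
      using regular_if_residuals_nonzero by blast
    then show "y \<in> (\<Union>t\<in>?I. {y. u_hat X (axis t 1) \<bullet> y = 0})"
      using u_hat_symmetric[of "axis t 1" y] by (auto simp: inner_axis inner_commute)
  qed
qed

lemma Omega_hat_measurable: "(\<lambda>y. Omega_hat w X R y $ i $ j) \<in> borel_measurable borel"
proof -
  have "Omega_hat w X R y $ i $ j = score y (axis i 1) \<bullet> (Weights *v score y (axis j 1))" for y
    unfolding Omega_hat_form[symmetric] by (simp add: matrix_vector_mult_basis column_def inner_axis')
  moreover have [measurable]: "(\<lambda>y. score y a) \<in> borel_measurable borel" for a
    unfolding score_def
    by (intro borel_measurable_continuous_onI continuous_intros linear_continuous_on
        linear_u_hat[unfolded linear_conv_bounded_linear])
  ultimately show ?thesis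
    by simp
qed

text \<open>
  Cramer's rule expresses the statistic through determinants of matrices with measurable entries.
\<close>
lemma test_stat_measurable [measurable]: "test_stat w X R r \<in> borel_measurable borel"
proof -
  note Omega_hat_measurable[measurable]
  have [measurable]: "(\<lambda>y. det (Omega_hat w X R y)) \<in> borel_measurable borel"
    by (rule borel_measurable_det) simp
  have b [measurable]: "(\<lambda>y. (R *v beta_hat X y - r) $ i) \<in> borel_measurable borel" for i
    by (intro borel_measurable_continuous_onI continuous_intros linear_continuous_on
        linear_beta_hat[unfolded linear_conv_bounded_linear] bounded_linear_compose[OF matrix_vector_mul_bounded_linear])
  have [measurable]: "(\<lambda>y. det (\<chi> i j. if j = k then (R *v beta_hat X y - r) $ i else Omega_hat w X R y $ i $ j))
    \<in> borel_measurable borel" for k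
    by (rule borel_measurable_det) (simp split: if_split del: vector_minus_component)
  have "test_stat w X R r = (\<lambda>y. if det (Omega_hat w X R y) \<noteq> 0 then
     (\<Sum>k\<in>UNIV. (R *v beta_hat X y - r) $ k *
        (det (\<chi> i j. if j = k then (R *v beta_hat X y - r) $ i else Omega_hat w X R y $ i $ j)
          / det (Omega_hat w X R y))) else 0)"
  proof
    fix y
    show "test_stat w X R r y = (if det (Omega_hat w X R y) \<noteq> 0 then
     (\<Sum>k\<in>UNIV. (R *v beta_hat X y - r) $ k *
        (det (\<chi> i j. if j = k then (R *v beta_hat X y - r) $ i else Omega_hat w X R y $ i $ j)
          / det (Omega_hat w X R y))) else 0)"
    proof (cases "det (Omega_hat w X R y) = 0")
      case False
      from cramer[OF this, of "matrix_inv (Omega_hat w X R y) *v (R *v beta_hat X y - r)" "R *v beta_hat X y - r"]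
      show ?thesis
        using False by (simp add: test_stat_def matrix_inv_mult_vector(1) inner_vec_def del: vector_minus_component)
    qed (simp add: test_stat_def)
  qed
  then show ?thesis
    by (simp del: vector_minus_component)
qed

text \<open>
  If the event were null, its image under each linear map that stretches the fitted part would be
  null, so \<open>T_0 < m\<close> would be a null event for every \<open>m\<close>; but these events exhaust the space.
\<close>
lemma not_null_below:
  assumes C: "0 < C"
  shows "{y. test_stat w X R 0 y < C} \<notin> null_sets lborel"
proof
  let ?T = "test_stat w X R 0"
  let ?F = "\<lambda>s z. u_hat X z + s *\<^sub>R (X *v beta_hat X z)"
  have lin: "linear (?F s)" for s
    by (rule linear_stretch)
  assume "{y. ?T y < C} \<in> null_sets lborel"
  then have neg: "negligible {y. ?T y < C}"
    by (simp add: negligible_iff_null_sets null_sets_completionI)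
  have "negligible {z. ?T z < real (Suc m)}" for m
  proof (rule negligible_subset)
    define s where "s = sqrt (C / real (Suc m))"
    have s: "s > 0" "s\<^sup>2 = C / real (Suc m)"
      using C by (simp_all add: s_def del: of_nat_Suc)
    show "negligible (?F (1 / s) ` {y. ?T y < C})"
      by (rule negligible_linear_image[OF lin neg])
    show "{z. ?T z < real (Suc m)} \<subseteq> ?F (1 / s) ` {y. ?T y < C}"
    proof
      fix z assume "z \<in> {z. ?T z < real (Suc m)}"
      then have "s\<^sup>2 * ?T z < C"
        using C by (simp add: s(2) field_simps del: of_nat_Suc)
      then have "?T (?F s z) < C"
        by (simp only: test_stat_stretch)
      moreover have "z = ?F (1 / s) (?F s z)"
        using s(1) fitted_plus_u_hat[of z] by (simp add: matrix_vector_mult_scaleR)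
      ultimately show "z \<in> ?F (1 / s) ` {y. ?T y < C}"
        by blast
    qed
  qed
  then have "negligible (\<Union>m. {z. ?T z < real (Suc m)})"
    by (intro negligible_countable_Union) auto
  moreover have "(\<Union>m. {z. ?T z < real (Suc m)}) = UNIV"
  proof -
    have "\<exists>m. ?T z < real (Suc m)" for z
    proof -
      obtain m where "?T z < real m"
        using reals_Archimedean2 by blast
      then have "?T z < real (Suc m)"
        by simp
      then show ?thesis ..
    qed
    then show ?thesis
      by auto
  qed
  ultimately show False
    by simp
qed

text \<open>
  As before, all events \<open>T_0 \<ge> C / m\<close> would be null, hence so would be \<open>T_0 > 0\<close>.  But \<open>T_0\<close> vanishes
  only where the estimator is singular or \<open>R \<beta>_hat = 0\<close>, and both are null events.
\<close>
lemma not_null_above: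
  assumes C: "0 < C"
  shows "{y. C \<le> test_stat w X R 0 y} \<notin> null_sets lborel"
proof
  let ?T = "test_stat w X R 0"
  let ?F = "\<lambda>s z. u_hat X z + s *\<^sub>R (X *v beta_hat X z)"
  have lin: "linear (?F s)" for s
    by (rule linear_stretch)
  assume "{y. C \<le> ?T y} \<in> null_sets lborel"
  then have neg: "negligible {y. C \<le> ?T y}"
    by (simp add: negligible_iff_null_sets null_sets_completionI)
  have "negligible {z. C / real (Suc m) \<le> ?T z}" for m
  proof (rule negligible_subset)
    define s where "s = sqrt (real (Suc m))"
    have s: "s > 0" "s\<^sup>2 = real (Suc m)"
      by (simp_all add: s_def del: of_nat_Suc)
    show "negligible (?F (1 / s) ` {y. C \<le> ?T y})"
      by (rule negligible_linear_image[OF lin neg])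
    show "{z. C / real (Suc m) \<le> ?T z} \<subseteq> ?F (1 / s) ` {y. C \<le> ?T y}"
    proof
      fix z assume "z \<in> {z. C / real (Suc m) \<le> ?T z}"
      then have "C \<le> s\<^sup>2 * ?T z"
        by (simp add: s(2) field_simps del: of_nat_Suc)
      then have "C \<le> ?T (?F s z)"
        by (simp only: test_stat_stretch)
      moreover have "z = ?F (1 / s) (?F s z)"
        using s(1) fitted_plus_u_hat[of z] by (simp add: matrix_vector_mult_scaleR)
      ultimately show "z \<in> ?F (1 / s) ` {y. C \<le> ?T y}"
        by blast
    qed
  qed
  then have "negligible (\<Union>m. {z. C / real (Suc m) \<le> ?T z})"
    by (intro negligible_countable_Union) auto
  \<comment> \<open>An arbitrary coordinate of the restriction, represented by the vector \<open>g\<close>.\<close>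
  moreover obtain i :: 'q where True
    by simp
  have "surj ((*v) R)"
    using rank_R full_rank_surjective by blast
  define g where "g = X *v (XXinv *v (transpose R *v axis i 1))"
  have g: "g \<bullet> y = (R *v beta_hat X y) $ i" for y
  proof -
    have "g \<bullet> y = axis i 1 \<bullet> (R *v beta_hat X y)"
      by (simp only: g_def beta_hat_eq inner_matrix_vector_mult[of "axis i 1" R] XXinv_symmetric inner_transpose(2))
    then show ?thesis
      by (simp add: inner_axis')
  qed
  have "g \<noteq> 0"
  proof
    assume "g = 0"
    obtain b where "R *v b = axis i 1"
      using \<open>surj ((*v) R)\<close> by (metis surjD)
    then show False
      using g[of "X *v b"] \<open>g = 0\<close> by simp
  qed
  then have "negligible {y. g \<bullet> y = 0}"
    using negligible_hyperplane by blast
  ultimately have "negligible ((\<Union>m. {z. C / real (Suc m) \<le> ?T z}) \<union> {y. g \<bullet> y = 0} \<union> {y. det (Omega_hat w X R y) = 0})"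
    using negligible_singular by (simp only: negligible_Un)
  moreover have "(\<Union>m. {z. C / real (Suc m) \<le> ?T z}) \<union> {y. g \<bullet> y = 0} \<union> {y. det (Omega_hat w X R y) = 0} = UNIV"
  proof -
    have "\<exists>m. C / real (Suc m) \<le> ?T z" if gz: "g \<bullet> z \<noteq> 0" and det: "det (Omega_hat w X R z) \<noteq> 0" for z
    proof -
      obtain K where "K > 0" "(norm (R *v beta_hat X z - 0))\<^sup>2 \<le> K * (norm z)\<^sup>2 * ?T z"
        using test_stat_lower_bound det by blast
      moreover have "R *v beta_hat X z \<noteq> 0"
        using gz g by auto
      ultimately have "?T z \<noteq> 0"
        by auto
      then have "?T z > 0"
        using test_stat_nonneg[of 0 z] by simp
      then obtain m where "C / ?T z < real m"
        using reals_Archimedean2 by blast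
      then have "C / real (Suc m) \<le> ?T z"
        using \<open>?T z > 0\<close> by (simp add: field_simps)
      then show ?thesis ..
    qed
    then show ?thesis
      by auto
  qed
  ultimately show False
    by (simp only: non_negligible_UNIV)
qed

end

section \<open>A triangular factor of the AR(1) covariance matrix\<close>

text \<open>
  A permutation other than the identity moves some index strictly upwards: otherwise it would lower
  or keep every position, and since the positions have a fixed sum, it would keep all of them.
\<close>
lemma det_lower_triangular:
  fixes A :: "real^'n::{finite,linorder}^'n::{finite,linorder}"
  assumes A: "\<And>i j. i < j \<Longrightarrow> A $ i $ j = 0"
  shows "det A = (\<Prod>i\<in>UNIV. A $ i $ i)"
proof -
  have "of_int (sign p) * (\<Prod>i\<in>UNIV. A $ i $ p i) = 0" if p: "p permutes UNIV" "p \<noteq> id" for p :: "'n \<Rightarrow> 'n"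
  proof -
    have "\<exists>i. i < p i"
    proof (rule ccontr)
      assume "\<nexists>i. i < p i"
      then have le: "pos (p i) \<le> pos i" for i
        using strict_mono_less_eq[OF strict_mono_pos] by (metis not_le)
      have "(\<Sum>i\<in>UNIV. pos (p i)) = (\<Sum>i\<in>(UNIV::'n set). pos i)"
        using sum.permute[OF p(1), of pos] unfolding o_def by (rule sym)
      then have "pos (p i) = pos i" for i
        using sum_mono_inv[of "\<lambda>i. pos (p i)" UNIV pos i] le by simp
      then have "p i = i" for i
        using strict_mono_eq[OF strict_mono_pos] by blast
      with p(2) show False
        by (simp add: fun_eq_iff)
    qed
    then obtain i where "i < p i" ..
    then have "(\<Prod>i\<in>UNIV. A $ i $ p i) = 0"
      using A by (intro prod_zero) auto
    then show ?thesis
      by simp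
  qed
  then have "(\<Sum>p\<in>{p. p permutes UNIV}. of_int (sign p) * (\<Prod>i\<in>UNIV. A $ i $ p i)) =
    (\<Sum>p\<in>{id}. of_int (sign p) * (\<Prod>i\<in>UNIV. A $ i $ p i))"
    by (intro sum.mono_neutral_right) (auto simp: permutes_id)
  then show ?thesis
    by (simp add: det_def sign_id)
qed

lemma pos_le_iff: "pos i \<le> pos j \<longleftrightarrow> i \<le> j"
  by (rule strict_mono_less_eq[OF strict_mono_pos])

lemma sum_pos: "(\<Sum>i\<in>UNIV. f (pos (i :: 'n::{finite,linorder}))) = (\<Sum>t = 1..CARD('n). f t)"
  by (rule sum.reindex_bij_betw[OF bij_betw_pos])

text \<open>
  The coefficients of the innovations in a stationary AR(1) process started at a standard normal value:
  \<open>y 1 = z 1\<close> and \<open>y t = \<rho> y (t - 1) + sqrt (1 - \<rho>\<^sup>2) z t\<close>.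
\<close>
definition AR1_coeff :: "real \<Rightarrow> nat \<Rightarrow> nat \<Rightarrow> real" where
  "AR1_coeff \<rho> t m = (if m = 1 then \<rho> ^ (t - 1) else if m \<le> t then sqrt (1 - \<rho>\<^sup>2) * \<rho> ^ (t - m) else 0)"

definition AR1_factor :: "real \<Rightarrow> real^'n::{finite,linorder}^'n::{finite,linorder}" where
  "AR1_factor \<rho> = (\<chi> i j. AR1_coeff \<rho> (pos i) (pos j))"

lemma AR1_coeff_Suc: "1 \<le> m \<Longrightarrow> m \<le> t \<Longrightarrow> AR1_coeff \<rho> (Suc t) m = \<rho> * AR1_coeff \<rho> t m"
  by (auto simp: AR1_coeff_def Suc_diff_le power_Suc[symmetric] simp del: power_Suc)

text \<open>
  One step of the recursion multiplies the earlier coefficients by \<open>\<rho>\<close>, so that the sum is multiplied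
  by \<open>\<rho>\<^sup>2\<close>, and adds \<open>(1 - \<rho>\<^sup>2) \<rho> ^ d\<close> for the new innovation.
\<close>
lemma sum_AR1_coeff:
  assumes \<rho>: "\<bar>\<rho>\<bar> < 1" and "1 \<le> t"
  shows "(\<Sum>m = 1..t. AR1_coeff \<rho> t m * AR1_coeff \<rho> (t + d) m) = \<rho> ^ d"
  using \<open>1 \<le> t\<close>
proof (induction t rule: dec_induct)
  case base
  show ?case
    by (simp add: AR1_coeff_def)
next
  case (step t)
  have "\<rho>\<^sup>2 \<le> 1"
    using \<rho> by (simp add: abs_square_le_1)
  then have sq: "(sqrt (1 - \<rho>\<^sup>2))\<^sup>2 = 1 - \<rho>\<^sup>2"
    by simp
  have "(\<Sum>m = 1..Suc t. AR1_coeff \<rho> (Suc t) m * AR1_coeff \<rho> (Suc t + d) m) =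
    (\<Sum>m = 1..t. \<rho>\<^sup>2 * (AR1_coeff \<rho> t m * AR1_coeff \<rho> (t + d) m))
      + AR1_coeff \<rho> (Suc t) (Suc t) * AR1_coeff \<rho> (Suc t + d) (Suc t)"
    by (auto simp: AR1_coeff_Suc power2_eq_square intro!: sum.cong)
  also have "AR1_coeff \<rho> (Suc t) (Suc t) * AR1_coeff \<rho> (Suc t + d) (Suc t) = (sqrt (1 - \<rho>\<^sup>2))\<^sup>2 * \<rho> ^ d"
    using step.hyps by (simp add: AR1_coeff_def power2_eq_square)
  also have "(\<Sum>m = 1..t. \<rho>\<^sup>2 * (AR1_coeff \<rho> t m * AR1_coeff \<rho> (t + d) m)) = \<rho>\<^sup>2 * \<rho> ^ d"
    unfolding sum_distrib_left[symmetric] step.IH ..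
  finally show ?case
    by (simp add: sq algebra_simps)
qed

lemma AR1_matrix_eq:
  assumes \<rho>: "\<bar>\<rho>\<bar> < 1"
  shows "AR1_matrix \<rho> = (AR1_factor \<rho> :: real^'n::{finite,linorder}^'n::{finite,linorder}) ** transpose (AR1_factor \<rho>)"
proof -
  have le: "(\<Sum>m = 1..CARD('n). AR1_coeff \<rho> t m * AR1_coeff \<rho> u m) = \<rho> ^ (u - t)"
    if "1 \<le> t" "t \<le> u" "u \<le> CARD('n)" for t u
  proof -
    have "(\<Sum>m = 1..CARD('n). AR1_coeff \<rho> t m * AR1_coeff \<rho> u m) = (\<Sum>m = 1..t. AR1_coeff \<rho> t m * AR1_coeff \<rho> u m)"
      using that by (intro sum.mono_neutral_right) (auto simp: AR1_coeff_def)
    then show ?thesis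
      using sum_AR1_coeff[OF \<rho> that(1), of "u - t"] that by simp
  qed
  have "(\<Sum>m = 1..CARD('n). AR1_coeff \<rho> (pos i) m * AR1_coeff \<rho> (pos j) m) = \<rho> ^ nat \<bar>int (pos i) - int (pos j)\<bar>"
    for i j :: 'n
  proof (cases "pos i \<le> pos j")
    case True
    then have "nat \<bar>int (pos i) - int (pos j)\<bar> = pos j - pos i"
      by linarith
    then show ?thesis
      using le[OF pos_bounds(1)[of i] True pos_bounds(2)[of j]] by (simp only:)
  next
    case False
    then have "nat \<bar>int (pos i) - int (pos j)\<bar> = pos i - pos j" and ge: "pos j \<le> pos i"
      by linarith+
    then show ?thesis
      using le[OF pos_bounds(1)[of j] ge pos_bounds(2)[of i]] by (simp only: mult.commute)
  qed
  then have "AR1_matrix \<rho> $ i $ j = ((AR1_factor \<rho> :: ((real, 'n) vec, 'n) vec) ** transpose (AR1_factor \<rho>)) $ i $ j" for i j :: 'n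
    unfolding AR1_matrix_def AR1_factor_def matrix_matrix_mult_def transpose_def vec_lambda_beta
    using sum_pos[of "\<lambda>m. AR1_coeff \<rho> (pos i) m * AR1_coeff \<rho> (pos j) m", where 'n='n] by (simp only:)
  then show ?thesis
    unfolding vec_eq_iff by blast
qed

lemma AR1_factor_controlled:
  assumes \<rho>: "\<bar>\<rho>\<bar> \<le> a" and a: "a < 1"
  shows "(AR1_factor \<rho> :: real^'n::{finite,linorder}^'n::{finite,linorder}) \<in> controlled 1 (sqrt (1 - a\<^sup>2) ^ CARD('n))"
proof -
  let ?L = "AR1_factor \<rho> :: real^'n::{finite,linorder}^'n::{finite,linorder}"
  have "\<rho>\<^sup>2 \<le> a\<^sup>2"
    using power_mono[OF \<rho>, of 2] by simp
  then have le: "sqrt (1 - a\<^sup>2) \<le> sqrt (1 - \<rho>\<^sup>2)"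
    by simp
  have "0 \<le> a" 
    using \<rho> by linarith
  then have a2: "0 < sqrt (1 - a\<^sup>2)" "sqrt (1 - a\<^sup>2) \<le> 1"
    using a by (simp_all add: power_less_one_iff abs_square_less_1)
  have pw: "\<bar>\<rho> ^ m\<bar> \<le> 1" for m
    using \<rho> a by (simp add: power_abs power_le_one)
  have s: "\<bar>sqrt (1 - \<rho>\<^sup>2)\<bar> \<le> 1"
    using \<rho> a by (simp add: abs_square_le_1)
  have "\<bar>sqrt (1 - \<rho>\<^sup>2) * \<rho> ^ m\<bar> \<le> 1" for m
    unfolding abs_mult using mult_mono[OF s pw[of m]] by simp
  then have "\<bar>?L $ i $ j\<bar> \<le> 1" for i j
    using pw by (simp add: AR1_factor_def AR1_coeff_def)
  moreover have "det ?L = (\<Prod>i\<in>UNIV. ?L $ i $ i)"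
  proof (rule det_lower_triangular)
    fix i j :: 'n
    assume "i < j"
    then have "pos i < pos j"
      by (rule strict_monoD[OF strict_mono_pos])
    then have "pos j \<noteq> 1" "\<not> pos j \<le> pos i"
      using pos_bounds(1)[of i] by linarith+
    then show "?L $ i $ j = 0"
      by (simp add: AR1_factor_def AR1_coeff_def)
  qed
  moreover have "(\<Prod>i\<in>(UNIV::'n set). sqrt (1 - a\<^sup>2)) \<le> (\<Prod>i\<in>UNIV. ?L $ i $ i)"
    by (rule prod_mono) (use le a2 in \<open>auto simp: AR1_factor_def AR1_coeff_def\<close>)
  ultimately show ?thesis
    by (simp add: controlled_def)
qed

text \<open>
  For \<open>s\<close> the sign of \<open>\<rho>\<close>, this is the factor above divided by \<open>sqrt (1 - \<rho>\<^sup>2)\<close>, where from the first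
  column of the quotient that multiple of \<open>(1, s, s\<^sup>2, \<dots>)\<close> is subtracted which makes its top entry 1.
  Without this correction the first column would be unbounded as \<open>\<bar>\<rho>\<bar>\<close> tends to 1.
\<close>
definition AR1_core :: "real \<Rightarrow> real \<Rightarrow> real^'n::{finite,linorder}^'n::{finite,linorder}" where
  "AR1_core s \<rho> = (\<chi> i j.
     if pos j = 1 then s ^ (pos i - 1) * (1 + (\<bar>\<rho>\<bar> ^ (pos i - 1) - 1) / sqrt (1 - \<rho>\<^sup>2))
     else if j \<le> i then \<rho> ^ (pos i - pos j) else 0)"

lemma AR1_factor_decomp:
  fixes z :: "(real, 'n::{finite,linorder}) vec"
  assumes \<rho>: "\<bar>\<rho>\<bar> < 1" and s: "\<rho> = s * \<bar>\<rho>\<bar>"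
  shows "AR1_factor \<rho> *v z = ((1 - sqrt (1 - \<rho>\<^sup>2)) * (\<Sum>j\<in>UNIV. if pos j = 1 then z $ j else 0)) *\<^sub>R (\<chi> i. s ^ (pos i - 1))
     + sqrt (1 - \<rho>\<^sup>2) *\<^sub>R (AR1_core s \<rho> *v z)"
proof -
  let ?\<tau> = "sqrt (1 - \<rho>\<^sup>2)"
  have \<tau>: "?\<tau> > 0"
    using \<rho> by (simp add: abs_square_less_1)
  have *: "AR1_factor \<rho> $ i $ j = (if pos j = 1 then s ^ (pos i - 1) * (1 - ?\<tau>) else 0) + ?\<tau> * AR1_core s \<rho> $ i $ j"
    for i j :: 'n
  proof (cases "pos j = 1")
    case True
    have "AR1_factor \<rho> $ i $ j = \<rho> ^ (pos i - 1)"
      using True by (simp add: AR1_factor_def AR1_coeff_def)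
    also have "\<dots> = s ^ (pos i - 1) * \<bar>\<rho>\<bar> ^ (pos i - 1)"
      using arg_cong[OF s, of "\<lambda>x. x ^ (pos i - 1)"] by (simp only: power_mult_distrib)
    also have "\<bar>\<rho>\<bar> ^ (pos i - 1) = (1 - ?\<tau>) + ?\<tau> * (1 + (\<bar>\<rho>\<bar> ^ (pos i - 1) - 1) / ?\<tau>)"
      using \<tau> by (simp add: distrib_left)
    also have "s ^ (pos i - 1) * ((1 - ?\<tau>) + ?\<tau> * (1 + (\<bar>\<rho>\<bar> ^ (pos i - 1) - 1) / ?\<tau>)) =
      s ^ (pos i - 1) * (1 - ?\<tau>) + ?\<tau> * (s ^ (pos i - 1) * (1 + (\<bar>\<rho>\<bar> ^ (pos i - 1) - 1) / ?\<tau>))"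
      by (simp only: distrib_left[of _ "1 - ?\<tau>"] mult.left_commute)
    also have "s ^ (pos i - 1) * (1 + (\<bar>\<rho>\<bar> ^ (pos i - 1) - 1) / ?\<tau>) = AR1_core s \<rho> $ i $ j"
      using True by (simp add: AR1_core_def)
    finally show ?thesis
      unfolding if_P[OF True] .
  next
    case False
    then show ?thesis
      by (simp add: AR1_factor_def AR1_coeff_def AR1_core_def pos_le_iff)
  qed
  show ?thesis
    unfolding vec_eq_iff
  proof
    fix i :: 'n
    let ?c = "s ^ (pos i - 1) * (1 - ?\<tau>)"
    have "(AR1_factor \<rho> *v z) $ i = (\<Sum>j\<in>UNIV. (if pos j = 1 then ?c else 0) * z $ j) + ?\<tau> * (AR1_core s \<rho> *v z) $ i"
      by (simp only: matrix_vector_mult_def vec_lambda_beta * distrib_right sum.distrib sum_distrib_left mult.assoc)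
    also have "(\<Sum>j\<in>UNIV. (if pos j = 1 then ?c else 0) * z $ j) = ?c * (\<Sum>j\<in>UNIV. if pos j = 1 then z $ j else 0)"
      unfolding sum_distrib_left by (rule sum.cong) simp_all
    finally show "(AR1_factor \<rho> *v z) $ i = (((1 - ?\<tau>) * (\<Sum>j\<in>UNIV. if pos j = 1 then z $ j else 0)) *\<^sub>R (\<chi> i. s ^ (pos i - 1))
     + ?\<tau> *\<^sub>R (AR1_core s \<rho> *v z)) $ i"
      by simp
  qed
qed

text \<open>
  The determinant is 1 by triangularity.  In the first column Bernoulli's inequality gives
  \<open>1 - \<bar>\<rho>\<bar> ^ m \<le> m (1 - \<bar>\<rho>\<bar>)\<close>, and \<open>1 - \<bar>\<rho>\<bar> \<le> sqrt (1 - \<rho>\<^sup>2)\<close>.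
\<close>
lemma AR1_core_controlled:
  assumes \<rho>: "\<bar>\<rho>\<bar> < 1" and s: "\<bar>s\<bar> = 1"
  shows "(AR1_core s \<rho> :: real^'n::{finite,linorder}^'n::{finite,linorder}) \<in> controlled (real CARD('n) + 1) 1"
proof -
  let ?A = "AR1_core s \<rho> :: real^'n::{finite,linorder}^'n::{finite,linorder}"
  let ?\<tau> = "sqrt (1 - \<rho>\<^sup>2)"
  have \<tau>: "?\<tau> > 0"
    using \<rho> by (simp add: abs_square_less_1)
  have "(1 - \<bar>\<rho>\<bar>) * (1 - \<bar>\<rho>\<bar>) \<le> (1 - \<bar>\<rho>\<bar>) * (1 + \<bar>\<rho>\<bar>)"
    using \<rho> by (intro mult_left_mono) auto
  then have "(1 - \<bar>\<rho>\<bar>)\<^sup>2 \<le> 1 - \<rho>\<^sup>2"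
    by (simp add: power2_eq_square algebra_simps)
  then have root: "1 - \<bar>\<rho>\<bar> \<le> ?\<tau>"
    by (rule real_le_rsqrt)
  have bern: "1 - \<bar>\<rho>\<bar> ^ m \<le> real m * (1 - \<bar>\<rho>\<bar>)" for m
    using Bernoulli_inequality[of "\<bar>\<rho>\<bar> - 1" m] by (simp add: algebra_simps)
  have "\<bar>(\<bar>\<rho>\<bar> ^ m - 1) / ?\<tau>\<bar> \<le> real m" for m
  proof -
    have "\<bar>\<rho>\<bar> ^ m \<le> 1"
      using \<rho> by (simp add: power_le_one)
    then have "\<bar>(\<bar>\<rho>\<bar> ^ m - 1) / ?\<tau>\<bar> = (1 - \<bar>\<rho>\<bar> ^ m) / ?\<tau>"
      using \<tau> by (simp add: abs_divide)
    also have "\<dots> \<le> real m * (1 - \<bar>\<rho>\<bar>) / ?\<tau>"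
      using bern \<tau> by (simp add: divide_right_mono)
    also have "\<dots> \<le> real m"
      using root \<tau> by (simp add: pos_divide_le_eq mult_left_mono)
    finally show ?thesis .
  qed
  then have col: "\<bar>1 + (\<bar>\<rho>\<bar> ^ (pos i - 1) - 1) / ?\<tau>\<bar> \<le> real CARD('n) + 1" for i :: 'n
    using pos_bounds(2)[of i] by (intro order_trans[OF abs_triangle_ineq])
      (smt (verit) diff_le_self le_trans of_nat_le_iff)
  have "\<bar>\<rho> ^ m\<bar> \<le> 1" for m
    using \<rho> by (simp add: power_abs power_le_one)
  then have "\<bar>\<rho> ^ m\<bar> \<le> real CARD('n) + 1" for m
    by (rule order_trans) simp
  then have "\<bar>?A $ i $ j\<bar> \<le> real CARD('n) + 1" for i j
    using col[of i] by (simp add: AR1_core_def abs_mult power_abs s)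
  moreover have "det ?A = (\<Prod>i\<in>UNIV. ?A $ i $ i)"
  proof (rule det_lower_triangular)
    fix i j :: 'n
    assume "i < j"
    then have "pos i < pos j"
      by (rule strict_monoD[OF strict_mono_pos])
    then have "pos j \<noteq> 1" "\<not> pos j \<le> pos i"
      using pos_bounds(1)[of i] by linarith+
    then show "?A $ i $ j = 0"
      by (simp add: AR1_core_def pos_le_iff[symmetric])
  qed
  moreover have "?A $ i $ i = 1" for i
    by (simp add: AR1_core_def)
  ultimately show ?thesis
    by (simp add: controlled_def)
qed

section \<open>Two properties of Gaussian measures and some order facts\<close>

lemma measure_gaussian_standard_symmetric:
  assumes [measurable]: "E \<in> sets borel"
  shows "measure (gaussian 0 (mat 1 :: real^'n^'n)) {z. - z \<in> E} = measure (gaussian 0 (mat 1)) E"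
proof -
  let ?J = "- mat 1 :: real^'n^'n"
  have "?J = (-1) *\<^sub>R mat 1"
    by simp
  then have det: "det ?J \<noteq> 0"
    by (simp only: det_scaleR) simp
  have J: "?J *v z = - z" for z :: "real^'n"
    using scaleR_matrix_vector_assoc[of "-1" "mat 1 :: real^'n^'n" z] by simp
  have "transpose ?J = ?J"
    by (simp add: transpose_def mat_def vec_eq_iff)
  then have JJ: "?J ** transpose ?J = mat 1"
    by (simp add: matrix_eq matrix_vector_mul_assoc[symmetric] J)
  have "measure (gaussian 0 (mat 1 :: real^'n^'n)) E = measure (distr (gaussian 0 (mat 1)) borel (\<lambda>z::real^'n. - z)) E"
    using gaussian_eq_distr[OF det, of 0] by (simp add: JJ J)
  also have "\<dots> = measure (gaussian 0 (mat 1 :: real^'n^'n)) {z. - z \<in> E}"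
    by (subst measure_distr) (simp_all add: vimage_def)
  finally show ?thesis ..
qed

lemma measure_gaussian_null:
  fixes A :: "real^'n^'n"
  assumes det: "det A \<noteq> 0" and E: "E \<in> null_sets lborel"
  shows "measure (gaussian 0 (mat 1)) {z. A *v z \<in> E} = 0"
proof -
  have [measurable]: "E \<in> sets borel"
    using E by auto
  obtain A' where A': "A ** A' = mat 1" "A' ** A = mat 1"
    using det by (auto simp: invertible_det_nz[symmetric] invertible_def)
  have "measure (gaussian 0 (mat 1)) {z. A *v z \<in> E} = measure (gaussian 0 (A ** transpose A)) E"
    unfolding gaussian_eq_distr[OF det] by (subst measure_distr) (simp_all add: vimage_def)
  moreover have "E \<in> null_sets (gaussian 0 (A ** transpose A))"
  proof -
    have "AE y in lborel. y \<in> E \<longrightarrow> f y = 0" for f :: "real^'n \<Rightarrow> ennreal"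
      using AE_not_in[OF E] by eventually_elim simp
    moreover have "E \<in> sets lborel"
      by simp
    ultimately show ?thesis
      unfolding gaussian_eq_density[OF A'] by (subst null_sets_density_iff, measurable) (intro conjI)
  qed
  ultimately show ?thesis
    by (simp add: measure_eq_0_null_sets)
qed

lemma cINF_unit_interval:
  fixes f :: "'a \<Rightarrow> real"
  assumes "A \<noteq> {}" and "\<And>x. x \<in> A \<Longrightarrow> 0 \<le> f x \<and> f x \<le> 1"
  shows "0 \<le> (INF x\<in>A. f x) \<and> (INF x\<in>A. f x) \<le> 1"
proof
  show "0 \<le> (INF x\<in>A. f x)"
    using assms by (intro cINF_greatest) auto
  obtain x where "x \<in> A"
    using assms(1) by blast
  then show "(INF x\<in>A. f x) \<le> 1"
    using assms(2) by (intro cINF_lower2[where x=x] bdd_belowI2[where m=0]) auto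
qed

lemma cSUP3_le:
  fixes f :: "'a \<Rightarrow> real \<Rightarrow> real \<Rightarrow> real"
  assumes "M \<noteq> {}" and "\<And>\<mu> \<sigma>2 \<rho>. \<mu> \<in> M \<Longrightarrow> 0 < \<sigma>2 \<Longrightarrow> \<bar>\<rho>\<bar> < 1 \<Longrightarrow> f \<mu> \<sigma>2 \<rho> \<le> B"
  shows "(SUP \<mu>\<in>M. SUP \<sigma>2\<in>{0<..}. SUP \<rho>\<in>{-1<..<1}. f \<mu> \<sigma>2 \<rho>) \<le> B"
proof (intro cSUP_least)
  show "{0::real<..} \<noteq> {}"
    by (metis empty_iff greaterThan_iff zero_less_one)
qed (use assms in auto)

lemma cINF3_ge:
  fixes f :: "'a \<Rightarrow> real \<Rightarrow> real \<Rightarrow> real"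
  assumes "M \<noteq> {}" and "\<And>\<mu> \<sigma>2 \<rho>. \<mu> \<in> M \<Longrightarrow> 0 < \<sigma>2 \<Longrightarrow> \<bar>\<rho>\<bar> < 1 \<Longrightarrow> B \<le> f \<mu> \<sigma>2 \<rho>"
  shows "B \<le> (INF \<mu>\<in>M. INF \<sigma>2\<in>{0<..}. INF \<rho>\<in>{-1<..<1}. f \<mu> \<sigma>2 \<rho>)"
proof (intro cINF_greatest)
  show "{0::real<..} \<noteq> {}"
    by (metis empty_iff greaterThan_iff zero_less_one)
qed (use assms in auto)

lemma tendsto_1_if_eventually_ge:
  fixes f :: "nat \<Rightarrow> real"
  assumes "\<And>m. f m \<le> 1" and "\<And>\<eta>. 0 < \<eta> \<Longrightarrow> \<forall>\<^sub>F m in sequentially. 1 - \<eta> \<le> f m"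
  shows "f \<longlonglongrightarrow> 1"
proof (rule order_tendstoI)
  fix a :: real assume "a < 1"
  then have "\<forall>\<^sub>F m in sequentially. 1 - (1 - a) / 2 \<le> f m"
    by (intro assms(2)) simp
  then show "\<forall>\<^sub>F m in sequentially. a < f m"
    by eventually_elim (use \<open>a < 1\<close> in \<open>simp add: field_simps\<close>)
next
  fix a :: real assume "1 < a"
  then show "\<forall>\<^sub>F m in sequentially. f m < a"
    using assms(1) by (auto intro: le_less_trans always_eventually)
qed

section \<open>Rejection probabilities, uniformly in the covariance factor\<close>

context regression
begin

definition rej_prob :: "((real, 'n) vec, 'n) vec \<Rightarrow> real^'q \<Rightarrow> real \<Rightarrow> real" where
  "rej_prob A r C = measure (gaussian 0 (mat 1)) {z. C \<le> test_stat w X R r (A *v z)}"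

lemma rej_prob_bounds: "0 \<le> rej_prob A r C \<and> rej_prob A r C \<le> 1"
proof -
  interpret N: prob_space "gaussian (0 :: (real, 'n) vec) (mat 1)"
    by (rule prob_space_gaussian_standard)
  show ?thesis
    by (simp add: rej_prob_def)
qed

lemma rej_prob_complement:
  "measure (gaussian 0 (mat 1)) {z. test_stat w X R r (A *v z) < C} = 1 - rej_prob A r C"
proof -
  interpret N: prob_space "gaussian (0 :: (real, 'n) vec) (mat 1)"
    by (rule prob_space_gaussian_standard)
  have "{z. C \<le> test_stat w X R r (A *v z)} \<in> sets borel"
    by measurable
  then have "N.prob (space (gaussian 0 (mat 1)) - {z. C \<le> test_stat w X R r (A *v z)}) = 1 - rej_prob A r C"
    unfolding rej_prob_def by (intro N.prob_compl) simp
  moreover have "space (gaussian 0 (mat 1)) - {z. C \<le> test_stat w X R r (A *v z)} = {z. test_stat w X R r (A *v z) < C}"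
    by auto
  ultimately show ?thesis
    by simp
qed

lemma rej_prob_lower:
  assumes "0 < C" "0 < d"
  shows "\<exists>p>0. \<forall>A\<in>controlled M d. p \<le> rej_prob A 0 C"
proof -
  have "{y. C \<le> test_stat w X R 0 y} \<in> sets borel"
    by measurable
  from measure_gaussian_controlled_ge[OF this not_null_above[OF \<open>0 < C\<close>] \<open>0 < d\<close>, of M]
  show ?thesis
    unfolding rej_prob_def mem_Collect_eq .
qed

lemma rej_prob_upper:
  assumes "0 < C" "0 < d"
  shows "\<exists>p>0. \<forall>A\<in>controlled M d. rej_prob A 0 C \<le> 1 - p"
proof -
  have B: "{y. test_stat w X R 0 y < C} \<in> sets borel"
    by measurable
  obtain p where "p > 0" "\<forall>A\<in>controlled M d. p \<le> measure (gaussian 0 (mat 1)) {z. A *v z \<in> {y. test_stat w X R 0 y < C}}"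
    using measure_gaussian_controlled_ge[OF B not_null_below[OF \<open>0 < C\<close>] \<open>0 < d\<close>, of M] by blast
  then show ?thesis
    by (intro exI[of _ p]) (auto simp: rej_prob_complement)
qed

text \<open>
  The standard Gaussian measure is symmetric, so the two events offered by the reflection property have
  the same probability.
\<close>
lemma rej_prob_shift:
  assumes C: "0 < C"
  shows "rej_prob A 0 C / 2 \<le> rej_prob A r C"
proof -
  interpret N: prob_space "gaussian (0 :: (real, 'n) vec) (mat 1)"
    by (rule prob_space_gaussian_standard)
  let ?E = "{z. C \<le> test_stat w X R r (A *v z)}"
  have [measurable]: "?E \<in> sets borel"
    by measurable
  then have E': "{z. - z \<in> ?E} \<in> sets borel"
    by measurable
  have "rej_prob A 0 C \<le> N.prob (?E \<union> {z. - z \<in> ?E})"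
    unfolding rej_prob_def
  proof (rule N.finite_measure_mono)
    show "{z. C \<le> test_stat w X R 0 (A *v z)} \<subseteq> ?E \<union> {z. - z \<in> ?E}"
      using test_stat_reflection[OF C] by (auto simp: linear_neg[OF matrix_vector_mul_linear])
    show "?E \<union> {z. - z \<in> ?E} \<in> sets (gaussian 0 (mat 1))"
      using E' by (simp add: sets.Un)
  qed
  also have "\<dots> \<le> N.prob ?E + N.prob {z. - z \<in> ?E}"
    using E' by (intro measure_Un_le) simp_all
  also have "\<dots> = 2 * rej_prob A r C"
    using measure_gaussian_standard_symmetric[of ?E] by (simp add: rej_prob_def)
  finally show ?thesis
    by simp
qed

text \<open>
  Acceptance at a regular point \<open>y = A z\<close> forces \<open>norm r \<le> \<kappa> norm y\<close>, and large values of \<open>norm (A z)\<close>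
  are uniformly unlikely.
\<close>
lemma rej_prob_far:
  assumes C: "0 < C" and d: "0 < d" and \<eta>: "0 < \<eta>"
  shows "\<exists>V>0. \<forall>r. V \<le> norm r \<longrightarrow> (\<forall>A\<in>controlled M d. 1 - \<eta> \<le> rej_prob A r C)"
proof -
  interpret N: prob_space "gaussian (0 :: (real, 'n) vec) (mat 1)"
    by (rule prob_space_gaussian_standard)
  obtain K where K: "K > 0" "\<And>y r. det (Omega_hat w X R y) \<noteq> 0 \<Longrightarrow>
     (norm (R *v beta_hat X y - r))\<^sup>2 \<le> K * (norm y)\<^sup>2 * test_stat w X R r y"
    using test_stat_lower_bound by blast
  have "linear (\<lambda>y. R *v beta_hat X y)"
    using linear_compose[OF linear_beta_hat matrix_vector_mul_linear[of R]] by (simp add: o_def)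
  from linear_bounded_pos[OF this]
  obtain K' where K': "K' > 0" "\<And>y. norm (R *v beta_hat X y) \<le> K' * norm y"
    by auto
  define \<kappa> where "\<kappa> = K' + sqrt (K * C)"
  have \<kappa>: "\<kappa> > 0"
    using K K' C by (simp add: \<kappa>_def add_pos_pos)
  let ?S = "{y. det (Omega_hat w X R y) = 0}"
  have sub: "norm r \<le> \<kappa> * norm y" if "test_stat w X R r y < C" "y \<notin> ?S" for r y
  proof -
    have "(norm (R *v beta_hat X y - r))\<^sup>2 \<le> K * (norm y)\<^sup>2 * test_stat w X R r y"
      using K that by blast
    also have "\<dots> \<le> K * (norm y)\<^sup>2 * C"
      using K that(1) by (intro mult_left_mono) auto
    also have "\<dots> = (sqrt (K * C) * norm y)\<^sup>2"
      using K C by (simp add: power_mult_distrib mult_ac)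
    finally have "norm (R *v beta_hat X y - r) \<le> sqrt (K * C) * norm y"
      by (rule power2_le_imp_le) (use K C in simp)
    moreover have "norm r \<le> norm (R *v beta_hat X y) + norm (R *v beta_hat X y - r)"
      using norm_triangle_sub[of r "R *v beta_hat X y"] by (simp add: norm_minus_commute)
    ultimately show ?thesis
      using K'(2)[of y] by (simp add: \<kappa>_def algebra_simps)
  qed
  have "(\<lambda>y. det (Omega_hat w X R y)) \<in> borel_measurable borel"
    by (rule borel_measurable_det) (rule Omega_hat_measurable)
  then have Sb: "?S \<in> sets borel"
    by measurable
  then have S0: "?S \<in> null_sets lborel"
    using negligible_singular by (simp add: negligible_iff_null_sets null_sets_completion_iff)
  let ?E = "\<lambda>m::nat. {y :: (real, 'n) vec. real m \<le> norm y}"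
  have "\<exists>m. \<forall>A\<in>controlled M d. measure (gaussian 0 (mat 1)) {z. A *v z \<in> ?E m} \<le> \<eta>"
  proof (rule measure_gaussian_controlled_tendsto_0[OF _ _ _ d \<eta>])
    show "decseq ?E"
      by (auto simp: decseq_def)
    have "\<exists>m. \<not> real m \<le> norm y" for y :: "(real, 'n) vec"
      using reals_Archimedean2[of "norm y"] by (auto simp: not_le)
    then show "(\<Inter>m. ?E m) = {}"
      by auto
  qed measurable
  then obtain m where m: "\<forall>A\<in>controlled M d. measure (gaussian 0 (mat 1)) {z. A *v z \<in> ?E m} \<le> \<eta>" ..
  show ?thesis
  proof (intro exI[of _ "\<kappa> * (real m + 1)"] conjI allI impI ballI)
    show "0 < \<kappa> * (real m + 1)"
      using \<kappa> by (simp add: add_nonneg_pos)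
    fix r :: "real^'q" and A :: "((real, 'n) vec, 'n) vec"
    assume r: "\<kappa> * (real m + 1) \<le> norm r" and A: "A \<in> controlled M d"
    have det: "det A \<noteq> 0"
      using A d by (auto simp: controlled_def)
    have "1 - rej_prob A r C = N.prob {z. test_stat w X R r (A *v z) < C}"
      by (simp add: rej_prob_complement)
    also have "\<dots> \<le> N.prob ({z. A *v z \<in> ?S} \<union> {z. A *v z \<in> ?E m})"
    proof (rule N.finite_measure_mono)
      show "{z. test_stat w X R r (A *v z) < C} \<subseteq> {z. A *v z \<in> ?S} \<union> {z. A *v z \<in> ?E m}"
      proof
        fix z assume z: "z \<in> {z. test_stat w X R r (A *v z) < C}"
        have "A *v z \<in> ?E m" if "A *v z \<notin> ?S"
        proof -
          have "\<kappa> * (real m + 1) \<le> \<kappa> * norm (A *v z)"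
            using sub[of r "A *v z"] z that r by auto
          then show ?thesis
            using \<kappa> by (simp del: distrib_left_numeral)
        qed
        then show "z \<in> {z. A *v z \<in> ?S} \<union> {z. A *v z \<in> ?E m}"
          by auto
      qed
      show "{z. A *v z \<in> ?S} \<union> {z. A *v z \<in> ?E m} \<in> sets (gaussian 0 (mat 1))"
        using measurable_sets[OF borel_measurable_matrix_vector_mult Sb, of A] by (auto simp: vimage_def)
    qed
    also have "\<dots> \<le> N.prob {z. A *v z \<in> ?S} + N.prob {z. A *v z \<in> ?E m}"
      using measurable_sets[OF borel_measurable_matrix_vector_mult Sb, of A]
      by (intro measure_Un_le) (auto simp: vimage_def)
    also have "\<dots> \<le> 0 + \<eta>"
      using measure_gaussian_null[OF det S0] m A by (intro add_mono) auto
    finally show "1 - \<eta> \<le> rej_prob A r C"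
      by simp
  qed
qed

text \<open>
  The events \<open>T_0 \<ge> m\<close> decrease to the empty set because the statistic is finite everywhere.
\<close>
lemma rej_prob_large_critical_value:
  assumes d: "0 < d" and \<delta>: "0 < \<delta>"
  shows "\<exists>C>0. \<forall>A\<in>controlled M d. rej_prob A 0 C \<le> \<delta>"
proof -
  let ?E = "\<lambda>m::nat. {y. real (Suc m) \<le> test_stat w X R 0 y}"
  have "\<exists>m. \<forall>A\<in>controlled M d. measure (gaussian 0 (mat 1)) {z. A *v z \<in> ?E m} \<le> \<delta>"
  proof (rule measure_gaussian_controlled_tendsto_0[OF _ _ _ d \<delta>])
    show "decseq ?E"
      by (auto simp: decseq_def)
    have "\<exists>m. \<not> real (Suc m) \<le> test_stat w X R 0 y" for y
    proof -
      obtain m where "test_stat w X R 0 y < real m"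
        using reals_Archimedean2 by blast
      then show ?thesis
        by (intro exI[of _ m]) simp
    qed
    then show "(\<Inter>m. ?E m) = {}"
      by auto
  qed measurable
  then obtain m where "\<forall>A\<in>controlled M d. rej_prob A 0 (real (Suc m)) \<le> \<delta>"
    unfolding rej_prob_def by auto
  then show ?thesis
    by (intro exI[of _ "real (Suc m)"]) simp
qed

lemma surj_R: "surj ((*v) R)"
  using rank_R by (simp only: full_rank_surjective)

lemma measure_rejection_region:
  assumes \<sigma>2: "0 < \<sigma>2" and \<rho>: "\<bar>\<rho>\<bar> < 1"
  shows "measure (gaussian (X *v b) (\<sigma>2 *\<^sub>R AR1_matrix \<rho>)) (rejection_region w X R r C)
    = rej_prob (AR1_factor \<rho>) ((r - R *v b) /\<^sub>R sqrt \<sigma>2) C"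
proof -
  let ?L = "AR1_factor \<rho> :: ((real, 'n) vec, 'n) vec"
  let ?B = "sqrt \<sigma>2 *\<^sub>R ?L"
  have "det ?L \<noteq> 0"
  proof -
    have "0 < sqrt (1 - \<bar>\<rho>\<bar>\<^sup>2)"
      using \<rho> by (simp add: abs_square_less_1)
    then have "0 < sqrt (1 - \<bar>\<rho>\<bar>\<^sup>2) ^ CARD('n)"
      by (rule zero_less_power)
    moreover have "?L \<in> controlled 1 (sqrt (1 - \<bar>\<rho>\<bar>\<^sup>2) ^ CARD('n))"
      by (rule AR1_factor_controlled[OF order_refl \<rho>])
    then have "sqrt (1 - \<bar>\<rho>\<bar>\<^sup>2) ^ CARD('n) \<le> \<bar>det ?L\<bar>"
      unfolding controlled_def by blast
    ultimately show ?thesis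
      by linarith
  qed
  then have det: "det ?B \<noteq> 0"
    using \<sigma>2 by (simp add: det_scaleR)
  have "\<sigma>2 *\<^sub>R AR1_matrix \<rho> = ?B ** transpose ?B"
    using \<sigma>2 by (simp add: AR1_matrix_eq[OF \<rho>] transpose_scalar scalar_matrix_assoc[symmetric] matrix_scalar_ac)
  then have "gaussian (X *v b) (\<sigma>2 *\<^sub>R AR1_matrix \<rho>)
      = distr (gaussian 0 (mat 1)) borel (\<lambda>z. X *v b + sqrt \<sigma>2 *\<^sub>R (?L *v z))"
    using gaussian_eq_distr[OF det, of "X *v b"] by (simp add: scaleR_matrix_vector_assoc)
  moreover have "rejection_region w X R r C \<in> sets borel"
    unfolding rejection_region_def by measurable
  moreover have "(\<lambda>z. X *v b + sqrt \<sigma>2 *\<^sub>R (?L *v z)) \<in> borel_measurable borel"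
    by measurable
  ultimately have "measure (gaussian (X *v b) (\<sigma>2 *\<^sub>R AR1_matrix \<rho>)) (rejection_region w X R r C)
     = measure (gaussian 0 (mat 1)) {z. X *v b + sqrt \<sigma>2 *\<^sub>R (?L *v z) \<in> rejection_region w X R r C}"
    by (simp add: measure_distr vimage_def)
  also have "\<dots> = rej_prob ?L ((r - R *v b) /\<^sub>R sqrt \<sigma>2) C"
    using \<sigma>2 by (simp add: rej_prob_def rejection_region_def test_stat_transform)
  finally show ?thesis .
qed

text \<open>
  A right inverse \<open>Q\<close> of \<open>R\<close> corrects \<open>b\<close> to the admissible coefficient vector \<open>b + Q (r - R b)\<close>.
\<close>
lemma infdist_mspan0_upper:
  "\<exists>\<kappa>>0. \<forall>b. infdist (X *v b) (mspan0 X R r) \<le> \<kappa> * norm (r - R *v b)"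
proof -
  obtain Q where Q: "R ** Q = mat 1"
    using surj_R matrix_right_invertible_surjective[of R] by auto
  from linear_bounded_pos[OF matrix_vector_mul_linear[of "X ** Q"]]
  obtain \<kappa> where \<kappa>: "\<kappa> > 0" "\<And>a. norm ((X ** Q) *v a) \<le> \<kappa> * norm a"
    by auto
  have "infdist (X *v b) (mspan0 X R r) \<le> \<kappa> * norm (r - R *v b)" for b
  proof -
    let ?b = "b + Q *v (r - R *v b)"
    have "R *v ?b = r"
      by (simp add: matrix_vector_right_distrib matrix_vector_mul_assoc Q)
    then have "X *v ?b \<in> mspan0 X R r"
      by (auto simp: mspan0_def)
    then have "infdist (X *v b) (mspan0 X R r) \<le> dist (X *v b) (X *v ?b)"
      by (rule infdist_le)
    also have "\<dots> = norm ((X ** Q) *v (r - R *v b))"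
      by (simp add: dist_norm matrix_vector_right_distrib matrix_vector_mul_assoc norm_minus_commute)
    also have "\<dots> \<le> \<kappa> * norm (r - R *v b)"
      by (rule \<kappa>)
    finally show ?thesis .
  qed
  with \<kappa>(1) show ?thesis
    by blast
qed

lemma mspan0_nonempty: "mspan0 X R r \<noteq> {}"
proof -
  obtain b where "r = R *v b"
    using surj_R by (rule surjE)
  then have "X *v b \<in> mspan0 X R r"
    by (auto simp: mspan0_def)
  then show ?thesis
    by blast
qed

text \<open>
  The infima of the power range over alternatives at a prescribed distance from the null; that there
  are such alternatives is what gives these infima their meaning.
\<close>
lemma mspan1_far_nonempty: "\<exists>\<mu>\<in>mspan1 X R r. c \<le> infdist \<mu> (mspan0 X R r)"
proof -
  have "linear (\<lambda>y. R *v beta_hat X y)"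
    using linear_compose[OF linear_beta_hat matrix_vector_mul_linear[of R]] by (simp add: o_def)
  from linear_bounded_pos[OF this]
  obtain K where K: "K > 0" "\<And>y. norm (R *v beta_hat X y) \<le> K * norm y"
    by auto
  define t where "t = K * (\<bar>c\<bar> + 1)"
  have t: "t > 0"
    using K by (simp add: t_def add_nonneg_pos)
  \<comment> \<open>Violating a single restriction, in an arbitrary coordinate, by \<open>t\<close> is enough.\<close>
  obtain i :: 'q where True
    by simp
  obtain b where b: "R *v b = r + t *\<^sub>R axis i 1"
    by (metis surj_R surjD)
  have far: "\<bar>c\<bar> + 1 \<le> dist (X *v b) y" if y: "y \<in> mspan0 X R r" for y
  proof -
    obtain b0 where b0: "y = X *v b0" "R *v b0 = r"
      using y by (auto simp: mspan0_def)
    have "t = norm (R *v beta_hat X (X *v b - y))"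
      using t by (simp add: b0 b matrix_vector_mult_diff_distrib norm_axis_1)
    also have "\<dots> \<le> K * dist (X *v b) y"
      unfolding dist_norm by (rule K(2))
    finally show ?thesis
      using K(1) by (simp add: t_def)
  qed
  then have "\<bar>c\<bar> + 1 \<le> infdist (X *v b) (mspan0 X R r)"
    using mspan0_nonempty by (simp add: infdist_notempty cINF_greatest)
  moreover have "X *v b \<in> mspan1 X R r"
    using far[of "X *v b"] by (auto simp: mspan1_def mspan_eq)
  ultimately show ?thesis
    by (intro bexI[of _ "X *v b"]) auto
qed

text \<open>
  The vector \<open>(1, s, s\<^sup>2, \<dots>)\<close> with \<open>s\<close> the sign of \<open>\<rho>\<close> is \<open>e_plus\<close> or \<open>- e_minus\<close>, so it equals \<open>X b\<close> with
  \<open>R b = 0\<close>; shifting by its multiples does not change the statistic.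
\<close>
lemma rej_prob_AR1_core:
  assumes \<rho>: "\<bar>\<rho>\<bar> < 1"
    and e: "e_plus \<in> mspan X" "e_minus \<in> mspan X" "R *v beta_hat X e_plus = 0" "R *v beta_hat X e_minus = 0"
  obtains A where "A \<in> controlled (real CARD('n) + 1) 1"
    and "\<And>r C. rej_prob (AR1_factor \<rho>) r C = rej_prob A (r /\<^sub>R sqrt (1 - \<rho>\<^sup>2)) C"
proof -
  define s :: real where "s = (if 0 \<le> \<rho> then 1 else -1)"
  have s: "\<bar>s\<bar> = 1" "\<rho> = s * \<bar>\<rho>\<bar>"
    by (simp_all add: s_def)
  let ?e = "(\<chi> i. s ^ (pos i - 1)) :: (real, 'n) vec"
  have "?e = e_plus \<or> ?e = - e_minus"
  proof (cases "0 \<le> \<rho>")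
    case False
    have "(-1) ^ (pos i - 1) = - ((-1) ^ pos i :: real)" for i :: 'n
      using pos_bounds(1)[of i] by (cases "pos i") auto
    then show ?thesis
      using False by (simp add: s_def e_minus_def vec_eq_iff)
  qed (simp add: s_def e_plus_def)
  moreover have "- e_minus \<in> mspan X" "R *v beta_hat X (- e_minus) = 0"
    using e(2,4) by (simp_all add: mspan_def span_neg linear_neg[OF matrix_vector_mul_linear])
  ultimately have "?e \<in> mspan X \<and> R *v beta_hat X ?e = 0"
    using e(1,3) by metis
  then obtain b where b: "?e = X *v b" "R *v b = 0"
    unfolding mspan_eq using beta_hat_fitted by (metis (no_types, lifting) rangeE)
  have "\<rho>\<^sup>2 < 1"
    using \<rho> by (simp add: abs_square_less_1)
  then have \<tau>: "sqrt (1 - \<rho>\<^sup>2) \<noteq> 0"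
    by simp
  have "test_stat w X R r (AR1_factor \<rho> *v z) = test_stat w X R (r /\<^sub>R sqrt (1 - \<rho>\<^sup>2)) (AR1_core s \<rho> *v z)" for r z
  proof -
    obtain c where "AR1_factor \<rho> *v z = c *\<^sub>R ?e + sqrt (1 - \<rho>\<^sup>2) *\<^sub>R (AR1_core s \<rho> *v z)"
      using AR1_factor_decomp[OF \<rho> s(2), of z] by blast
    also have "c *\<^sub>R ?e = X *v (c *\<^sub>R b)"
      by (simp only: matrix_vector_mult_scaleR b(1))
    finally show ?thesis
      using test_stat_transform[OF \<tau>, of r "c *\<^sub>R b"] by (simp only: b(2) matrix_vector_mult_scaleR scaleR_zero_right diff_zero)
  qed
  then show thesis
    by (intro that[OF AR1_core_controlled[OF \<rho> s(1)]]) (simp add: rej_prob_def)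
qed

section \<open>Size and power in the AR(1) model\<close>

lemma measure_rejection_region_unit:
  assumes "\<mu> \<in> mspan X" "0 < \<sigma>2" "\<bar>\<rho>\<bar> < 1"
  shows "0 \<le> measure (gaussian \<mu> (\<sigma>2 *\<^sub>R AR1_matrix \<rho>)) (rejection_region w X R r C) \<and>
    measure (gaussian \<mu> (\<sigma>2 *\<^sub>R AR1_matrix \<rho>)) (rejection_region w X R r C) \<le> 1"
proof -
  obtain b where "\<mu> = X *v b"
    using assms(1) by (auto simp: mspan_eq)
  then show ?thesis
    using rej_prob_bounds by (simp only: measure_rejection_region[OF assms(2,3)])
qed

lemma measure_rejection_region_core:
  assumes e: "e_plus \<in> mspan X" "e_minus \<in> mspan X" "R *v beta_hat X e_plus = 0" "R *v beta_hat X e_minus = 0"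
    and "0 < \<sigma>2" and \<rho>: "\<bar>\<rho>\<bar> < 1"
  shows "\<exists>A\<in>controlled (real CARD('n) + 1) 1.
    measure (gaussian (X *v b) (\<sigma>2 *\<^sub>R AR1_matrix \<rho>)) (rejection_region w X R r C)
      = rej_prob A ((r - R *v b) /\<^sub>R sqrt \<sigma>2 /\<^sub>R sqrt (1 - \<rho>\<^sup>2)) C"
proof -
  obtain A where "A \<in> controlled (real CARD('n) + 1) 1"
    and "\<And>r C. rej_prob (AR1_factor \<rho>) r C = rej_prob A (r /\<^sub>R sqrt (1 - \<rho>\<^sup>2)) C"
    using rej_prob_AR1_core[OF \<rho> e] by blast
  then show ?thesis
    using measure_rejection_region[OF \<open>0 < \<sigma>2\<close> \<rho>, of b r C] by metis
qed

text \<open>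
  The effective restriction vector is \<open>(r - R b) / (\<sigma> sqrt (1 - \<rho>\<^sup>2))\<close>.  A distance of at least \<open>c \<sigma>\<close>
  from the null bounds \<open>norm (r - R b) / \<sigma>\<close> from below, so the vector becomes arbitrarily long as
  \<open>\<bar>\<rho>\<bar>\<close> tends to 1.
\<close>
lemma power_tendsto_1_near_unit_root:
  assumes e: "e_plus \<in> mspan X" "e_minus \<in> mspan X" "R *v beta_hat X e_plus = 0" "R *v beta_hat X e_minus = 0"
    and C: "0 < C" and c: "0 < c" and \<rho>: "\<And>m::nat. \<bar>\<rho> m\<bar> < 1" "(\<lambda>m. \<bar>\<rho> m\<bar>) \<longlonglongrightarrow> 1"
  shows "(\<lambda>m. INF (\<mu>1, \<sigma>2)\<in>{(\<mu>1, \<sigma>2). \<mu>1 \<in> mspan1 X R r \<and> 0 < \<sigma>2 \<and>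
                                     infdist \<mu>1 (mspan0 X R r) / sqrt \<sigma>2 \<ge> c}.
                measure (gaussian \<mu>1 (\<sigma>2 *\<^sub>R AR1_matrix (\<rho> m))) (rejection_region w X R r C))
               \<longlonglongrightarrow> 1"
    (is "(\<lambda>m. INF (\<mu>1, \<sigma>2)\<in>?D. ?P m \<mu>1 \<sigma>2) \<longlonglongrightarrow> 1")
proof -
  obtain \<mu> where "\<mu> \<in> mspan1 X R r" "c \<le> infdist \<mu> (mspan0 X R r)"
    using mspan1_far_nonempty by blast
  then have "(\<mu>, 1) \<in> ?D"
    by simp
  then have ne: "?D \<noteq> {}"
    by blast
  obtain \<kappa> where \<kappa>: "\<kappa> > 0" "\<And>b. infdist (X *v b) (mspan0 X R r) \<le> \<kappa> * norm (r - R *v b)"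
    using infdist_mspan0_upper by blast
  show ?thesis
  proof (rule tendsto_1_if_eventually_ge)
    fix m
    have "0 \<le> ?P m (fst x) (snd x) \<and> ?P m (fst x) (snd x) \<le> 1" if "x \<in> ?D" for x
      using that by (intro measure_rejection_region_unit \<rho>(1)) (auto simp: mspan1_def)
    then show "(INF (\<mu>1, \<sigma>2)\<in>?D. ?P m \<mu>1 \<sigma>2) \<le> 1"
      unfolding case_prod_unfold using cINF_unit_interval[OF ne, of "\<lambda>x. ?P m (fst x) (snd x)"] by (simp add: case_prod_unfold)
  next
    fix \<eta> :: real assume "0 < \<eta>"
    then obtain V where V: "V > 0" "\<And>r A. V \<le> norm r \<Longrightarrow> A \<in> controlled (real CARD('n) + 1) 1 \<Longrightarrow> 1 - \<eta> \<le> rej_prob A r C"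
      using rej_prob_far[OF C zero_less_one] by metis
    have "(\<lambda>m. sqrt (1 - \<bar>\<rho> m\<bar>\<^sup>2) * (\<kappa> * V)) \<longlonglongrightarrow> sqrt (1 - 1\<^sup>2) * (\<kappa> * V)"
      by (intro tendsto_intros \<rho>(2))
    then have "(\<lambda>m. sqrt (1 - (\<rho> m)\<^sup>2) * (\<kappa> * V)) \<longlonglongrightarrow> 0"
      by simp
    then have "\<forall>\<^sub>F m in sequentially. sqrt (1 - (\<rho> m)\<^sup>2) * (\<kappa> * V) < c"
      using c by (rule order_tendstoD)
    then show "\<forall>\<^sub>F m in sequentially. 1 - \<eta> \<le> (INF (\<mu>1, \<sigma>2)\<in>?D. ?P m \<mu>1 \<sigma>2)"
    proof eventually_elim
      fix m assume m: "sqrt (1 - (\<rho> m)\<^sup>2) * (\<kappa> * V) < c"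
      have "1 - \<eta> \<le> ?P m \<mu>1 \<sigma>2" if D: "(\<mu>1, \<sigma>2) \<in> ?D" for \<mu>1 \<sigma>2
      proof -
        have \<sigma>2: "0 < \<sigma>2" and far: "c \<le> infdist \<mu>1 (mspan0 X R r) / sqrt \<sigma>2" and "\<mu>1 \<in> mspan X"
          using D by (auto simp: mspan1_def)
        then obtain b where b: "\<mu>1 = X *v b"
          by (auto simp: mspan_eq)
        obtain A where A: "A \<in> controlled (real CARD('n) + 1) 1"
          and P: "?P m \<mu>1 \<sigma>2 = rej_prob A ((r - R *v b) /\<^sub>R sqrt \<sigma>2 /\<^sub>R sqrt (1 - (\<rho> m)\<^sup>2)) C"
          using measure_rejection_region_core[OF e \<sigma>2 \<rho>(1)] unfolding b by blast
        have "(\<rho> m)\<^sup>2 < 1"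
          using \<rho>(1) by (simp add: abs_square_less_1)
        then have \<tau>: "0 < sqrt (1 - (\<rho> m)\<^sup>2)"
          by simp
        have "\<kappa> * (V * sqrt (1 - (\<rho> m)\<^sup>2)) \<le> c"
          using m by (simp add: mult_ac)
        also have "c \<le> \<kappa> * norm (r - R *v b) / sqrt \<sigma>2"
          using far \<kappa>(2)[of b] \<sigma>2 unfolding b by (intro order_trans[OF far[unfolded b]] divide_right_mono) auto
        finally have "\<kappa> * (V * sqrt (1 - (\<rho> m)\<^sup>2)) \<le> \<kappa> * (norm (r - R *v b) / sqrt \<sigma>2)"
          by simp
        then have "V * sqrt (1 - (\<rho> m)\<^sup>2) \<le> norm (r - R *v b) / sqrt \<sigma>2"
          using \<kappa>(1) by (rule mult_left_le_imp_le)
        then have "V \<le> norm (r - R *v b) / sqrt \<sigma>2 / sqrt (1 - (\<rho> m)\<^sup>2)"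
          using \<tau> by (simp only: pos_le_divide_eq)
        also have "\<dots> = norm ((r - R *v b) /\<^sub>R sqrt \<sigma>2 /\<^sub>R sqrt (1 - (\<rho> m)\<^sup>2))"
          using \<sigma>2 \<tau> by (simp only: norm_scaleR abs_inverse abs_of_pos real_sqrt_gt_0_iff divide_inverse mult_ac)
        finally show ?thesis
          unfolding P using A by (rule V(2))
      qed
      then show "1 - \<eta> \<le> (INF (\<mu>1, \<sigma>2)\<in>?D. ?P m \<mu>1 \<sigma>2)"
        using ne by (intro cINF_greatest) auto
    qed
  qed
qed

text \<open>
  For \<open>\<bar>\<rho>\<bar> \<le> 1 - \<epsilon>\<close> the triangular factors themselves have determinants bounded away from zero, and
  the restriction vector \<open>(r - R b) / \<sigma>\<close> grows because \<open>c / \<sigma>\<close> does.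
\<close>
lemma power_tendsto_1_away_from_unit_root:
  fixes \<sigma>2 c :: "nat \<Rightarrow> real"
  assumes C: "0 < C" and \<sigma>2: "\<And>m. 0 < \<sigma>2 m" and \<epsilon>: "0 < \<epsilon>" "\<epsilon> < 1"
    and lim: "filterlim (\<lambda>m. c m / sqrt (\<sigma>2 m)) at_top sequentially"
  shows "(\<lambda>m. INF \<mu>1\<in>{\<mu>1 \<in> mspan1 X R r. infdist \<mu>1 (mspan0 X R r) \<ge> c m}.
               INF \<rho>\<in>{-1 + \<epsilon>..1 - \<epsilon>}.
                 measure (gaussian \<mu>1 (\<sigma>2 m *\<^sub>R AR1_matrix \<rho>)) (rejection_region w X R r C))
          \<longlonglongrightarrow> 1"
    (is "(\<lambda>m. INF \<mu>1\<in>?D m. INF \<rho>\<in>?I. ?P m \<mu>1 \<rho>) \<longlonglongrightarrow> 1")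
proof -
  have ne: "?D m \<noteq> {}" for m
    using mspan1_far_nonempty by blast
  have neI: "?I \<noteq> {}"
    using \<epsilon> by simp
  have I: "\<bar>\<rho>\<bar> \<le> 1 - \<epsilon>" "\<bar>\<rho>\<bar> < 1" if "\<rho> \<in> ?I" for \<rho>
    using that \<epsilon> by auto
  define d where "d = sqrt (1 - (1 - \<epsilon>)\<^sup>2) ^ CARD('n)"
  have "(1 - \<epsilon>)\<^sup>2 < 1"
    using \<epsilon> by (simp add: abs_square_less_1)
  then have d: "0 < d"
    unfolding d_def by (intro zero_less_power) simp
  obtain \<kappa> where \<kappa>: "\<kappa> > 0" "\<And>b. infdist (X *v b) (mspan0 X R r) \<le> \<kappa> * norm (r - R *v b)"
    using infdist_mspan0_upper by blast
  show ?thesis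
  proof (rule tendsto_1_if_eventually_ge)
    fix m
    have "0 \<le> (INF \<rho>\<in>?I. ?P m \<mu>1 \<rho>) \<and> (INF \<rho>\<in>?I. ?P m \<mu>1 \<rho>) \<le> 1" if "\<mu>1 \<in> ?D m" for \<mu>1
      using that by (intro cINF_unit_interval[OF neI] measure_rejection_region_unit \<sigma>2 I) (auto simp: mspan1_def)
    then show "(INF \<mu>1\<in>?D m. INF \<rho>\<in>?I. ?P m \<mu>1 \<rho>) \<le> 1"
      by (rule cINF_unit_interval[OF ne, THEN conjunct2])
  next
    fix \<eta> :: real assume "0 < \<eta>"
    then obtain V where V: "V > 0" "\<And>r A. V \<le> norm r \<Longrightarrow> A \<in> controlled 1 d \<Longrightarrow> 1 - \<eta> \<le> rej_prob A r C"
      using rej_prob_far[OF C d] by metis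
    have "\<forall>\<^sub>F m in sequentially. \<kappa> * V \<le> c m / sqrt (\<sigma>2 m)"
      using lim by (simp add: filterlim_at_top)
    then show "\<forall>\<^sub>F m in sequentially. 1 - \<eta> \<le> (INF \<mu>1\<in>?D m. INF \<rho>\<in>?I. ?P m \<mu>1 \<rho>)"
    proof eventually_elim
      fix m assume m: "\<kappa> * V \<le> c m / sqrt (\<sigma>2 m)"
      show "1 - \<eta> \<le> (INF \<mu>1\<in>?D m. INF \<rho>\<in>?I. ?P m \<mu>1 \<rho>)"
      proof (intro cINF_greatest ne neI)
        fix \<mu>1 \<rho> assume \<mu>1: "\<mu>1 \<in> ?D m" and \<rho>: "\<rho> \<in> ?I"
        then obtain b where b: "\<mu>1 = X *v b"
          by (auto simp: mspan1_def mspan_eq)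
        have "c m \<le> \<kappa> * norm (r - R *v b)"
          using \<mu>1 \<kappa>(2)[of b] by (simp add: b)
        then have "c m / sqrt (\<sigma>2 m) \<le> \<kappa> * norm (r - R *v b) / sqrt (\<sigma>2 m)"
          using \<sigma>2[of m] by (intro divide_right_mono) auto
        with m have "\<kappa> * V \<le> \<kappa> * (norm (r - R *v b) / sqrt (\<sigma>2 m))"
          by simp
        then have "V \<le> norm (r - R *v b) / sqrt (\<sigma>2 m)"
          using \<kappa>(1) by (rule mult_left_le_imp_le)
        also have "\<dots> = norm ((r - R *v b) /\<^sub>R sqrt (\<sigma>2 m))"
          using \<sigma>2[of m] by (simp only: norm_scaleR abs_inverse abs_of_pos real_sqrt_gt_0_iff divide_inverse mult_ac)
        finally have "V \<le> norm ((r - R *v b) /\<^sub>R sqrt (\<sigma>2 m))" .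
        moreover have "AR1_factor \<rho> \<in> (controlled 1 d :: ((real, 'n) vec, 'n) vec set)"
          unfolding d_def by (rule AR1_factor_controlled) (use I[OF \<rho>] \<epsilon> in auto)
        ultimately show "1 - \<eta> \<le> ?P m \<mu>1 \<rho>"
          unfolding b measure_rejection_region[OF \<sigma>2 I(2)[OF \<rho>]] by (rule V(2))
      qed
    qed
  qed
qed

end

theorem theorem3p7:
  fixes X :: "real^'k^'n::{finite,linorder}"
    and R :: "real^'k^'q"
    and r :: "real^'q"
    and w :: "int \<Rightarrow> real"
  assumes "CARD('k) < CARD('n)"
    and "rank X = CARD('k)"
    and "rank R = CARD('q)"
    and "admissible_weights TYPE('n) w"
    and "rank_condition X R"
  shows
    "(e_plus \<in> mspan X \<and> e_minus \<in> mspan X \<and>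
      R *v beta_hat X e_plus = 0 \<and> R *v beta_hat X e_minus = 0 \<longrightarrow>
        (\<forall>C>0.
          (SUP \<mu>0\<in>mspan0 X R r. SUP \<sigma>2\<in>{0<..}. SUP \<rho>\<in>{-1<..<1}.
             measure (gaussian \<mu>0 (\<sigma>2 *\<^sub>R AR1_matrix \<rho>)) (rejection_region w X R r C)) < 1 \<and>
          (INF \<mu>0\<in>mspan0 X R r. INF \<sigma>2\<in>{0<..}. INF \<rho>\<in>{-1<..<1}.
             measure (gaussian \<mu>0 (\<sigma>2 *\<^sub>R AR1_matrix \<rho>)) (rejection_region w X R r C)) > 0 \<and>
          (INF \<mu>1\<in>mspan1 X R r. INF \<sigma>2\<in>{0<..}. INF \<rho>\<in>{-1<..<1}.
             measure (gaussian \<mu>1 (\<sigma>2 *\<^sub>R AR1_matrix \<rho>)) (rejection_region w X R r C)) > 0 \<and>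
          (\<forall>c>0. \<forall>\<rho> :: nat \<Rightarrow> real.
             (\<forall>m. \<rho> m \<in> {-1<..<1}) \<and> (\<lambda>m. \<bar>\<rho> m\<bar>) \<longlonglongrightarrow> 1 \<longrightarrow>
             (\<lambda>m. INF (\<mu>1, \<sigma>2)\<in>{(\<mu>1, \<sigma>2). \<mu>1 \<in> mspan1 X R r \<and> 0 < \<sigma>2 \<and>
                                     infdist \<mu>1 (mspan0 X R r) / sqrt \<sigma>2 \<ge> c}.
                measure (gaussian \<mu>1 (\<sigma>2 *\<^sub>R AR1_matrix (\<rho> m))) (rejection_region w X R r C))
               \<longlonglongrightarrow> 1)) \<and>
        (\<forall>\<delta>. 0 < \<delta> \<and> \<delta> < 1 \<longrightarrow> (\<exists>C>0.
          (SUP \<mu>0\<in>mspan0 X R r. SUP \<sigma>2\<in>{0<..}. SUP \<rho>\<in>{-1<..<1}.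
             measure (gaussian \<mu>0 (\<sigma>2 *\<^sub>R AR1_matrix \<rho>)) (rejection_region w X R r C)) \<le> \<delta>)))
     \<and>
     (\<forall>C>0. \<forall>(c :: nat \<Rightarrow> real) (\<sigma>2 :: nat \<Rightarrow> real) \<epsilon>.
        (\<forall>m. 0 < c m) \<and> (\<forall>m. 0 < \<sigma>2 m) \<and> 0 < \<epsilon> \<and> \<epsilon> < 1 \<and>
        filterlim (\<lambda>m. c m / sqrt (\<sigma>2 m)) at_top sequentially \<longrightarrow>
        (\<lambda>m. INF \<mu>1\<in>{\<mu>1 \<in> mspan1 X R r. infdist \<mu>1 (mspan0 X R r) \<ge> c m}.
               INF \<rho>\<in>{-1 + \<epsilon>..1 - \<epsilon>}.
                 measure (gaussian \<mu>1 (\<sigma>2 m *\<^sub>R AR1_matrix \<rho>)) (rejection_region w X R r C))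
          \<longlonglongrightarrow> 1)"
proof -
  interpret regression X R w
    by unfold_locales (fact assms)+
  let ?e = "e_plus \<in> mspan X \<and> e_minus \<in> mspan X \<and>
    R *v beta_hat X e_plus = 0 \<and> R *v beta_hat X e_minus = 0"
  let ?K = "controlled (real CARD('n) + 1) 1 :: (real^'n::{finite,linorder}^'n::{finite,linorder}) set"
  let ?P = "\<lambda>C \<mu> \<sigma>2 \<rho>. measure (gaussian \<mu> (\<sigma>2 *\<^sub>R AR1_matrix \<rho>)) (rejection_region w X R r C)"
  have ne0: "mspan0 X R r \<noteq> {}"
    by (rule mspan0_nonempty)
  have ne1: "mspan1 X R r \<noteq> {}"
    using mspan1_far_nonempty by blast
  have null: "\<exists>A\<in>?K. ?P C \<mu> \<sigma>2 \<rho> = rej_prob A 0 C"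
    if e: ?e and "\<mu> \<in> mspan0 X R r" "0 < \<sigma>2" "\<bar>\<rho>\<bar> < 1" for C \<mu> \<sigma>2 \<rho>
  proof -
    obtain b where "\<mu> = X *v b" "R *v b = r"
      using \<open>\<mu> \<in> mspan0 X R r\<close> by (auto simp: mspan0_def)
    then show ?thesis
      using measure_rejection_region_core[of \<sigma>2 \<rho> b r C] e \<open>0 < \<sigma>2\<close> \<open>\<bar>\<rho>\<bar> < 1\<close> by simp
  qed
  have alt: "\<exists>A\<in>?K. \<exists>v. ?P C \<mu> \<sigma>2 \<rho> = rej_prob A v C"
    if e: ?e and "\<mu> \<in> mspan1 X R r" "0 < \<sigma>2" "\<bar>\<rho>\<bar> < 1" for C \<mu> \<sigma>2 \<rho>
  proof -
    obtain b where "\<mu> = X *v b"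
      using \<open>\<mu> \<in> mspan1 X R r\<close> by (auto simp: mspan1_def mspan_eq)
    then show ?thesis
      using measure_rejection_region_core[of \<sigma>2 \<rho> b r C] e \<open>0 < \<sigma>2\<close> \<open>\<bar>\<rho>\<bar> < 1\<close> by blast
  qed
  have size: "(SUP \<mu>0\<in>mspan0 X R r. SUP \<sigma>2\<in>{0<..}. SUP \<rho>\<in>{-1<..<1}. ?P C \<mu>0 \<sigma>2 \<rho>) < 1"
    if e: ?e and C: "0 < C" for C
  proof -
    obtain p where "0 < p" and p: "\<And>A. A \<in> ?K \<Longrightarrow> rej_prob A 0 C \<le> 1 - p"
      using rej_prob_upper[OF C zero_less_one] by blast
    have "(SUP \<mu>0\<in>mspan0 X R r. SUP \<sigma>2\<in>{0<..}. SUP \<rho>\<in>{-1<..<1}. ?P C \<mu>0 \<sigma>2 \<rho>) \<le> 1 - p"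
      by (rule cSUP3_le[OF ne0]) (metis null[OF e] p)
    then show ?thesis
      using \<open>0 < p\<close> by linarith
  qed
  have null_pos: "0 < (INF \<mu>0\<in>mspan0 X R r. INF \<sigma>2\<in>{0<..}. INF \<rho>\<in>{-1<..<1}. ?P C \<mu>0 \<sigma>2 \<rho>)"
    if e: ?e and C: "0 < C" for C
  proof -
    obtain p where "0 < p" and p: "\<And>A. A \<in> ?K \<Longrightarrow> p \<le> rej_prob A 0 C"
      using rej_prob_lower[OF C zero_less_one] by blast
    have "p \<le> (INF \<mu>0\<in>mspan0 X R r. INF \<sigma>2\<in>{0<..}. INF \<rho>\<in>{-1<..<1}. ?P C \<mu>0 \<sigma>2 \<rho>)"
      by (rule cINF3_ge[OF ne0]) (metis null[OF e] p)
    then show ?thesis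
      using \<open>0 < p\<close> by linarith
  qed
  have power_pos: "0 < (INF \<mu>1\<in>mspan1 X R r. INF \<sigma>2\<in>{0<..}. INF \<rho>\<in>{-1<..<1}. ?P C \<mu>1 \<sigma>2 \<rho>)"
    if e: ?e and C: "0 < C" for C
  proof -
    obtain p where "0 < p" and p: "\<And>A. A \<in> ?K \<Longrightarrow> p \<le> rej_prob A 0 C"
      using rej_prob_lower[OF C zero_less_one] by blast
    have pv: "p / 2 \<le> rej_prob A v C" if "A \<in> ?K" for A v
      using p[OF that] rej_prob_shift[OF C, of A v] by linarith
    have "p / 2 \<le> (INF \<mu>1\<in>mspan1 X R r. INF \<sigma>2\<in>{0<..}. INF \<rho>\<in>{-1<..<1}. ?P C \<mu>1 \<sigma>2 \<rho>)"
      by (rule cINF3_ge[OF ne1]) (metis alt[OF e] pv)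
    then show ?thesis
      using \<open>0 < p\<close> by linarith
  qed
  have small: "\<exists>C>0. (SUP \<mu>0\<in>mspan0 X R r. SUP \<sigma>2\<in>{0<..}. SUP \<rho>\<in>{-1<..<1}. ?P C \<mu>0 \<sigma>2 \<rho>) \<le> \<delta>"
    if e: ?e and \<delta>: "0 < \<delta>" for \<delta>
  proof -
    obtain C where "0 < C" and C: "\<And>A. A \<in> ?K \<Longrightarrow> rej_prob A 0 C \<le> \<delta>"
      using rej_prob_large_critical_value[OF zero_less_one \<delta>] by blast
    have "(SUP \<mu>0\<in>mspan0 X R r. SUP \<sigma>2\<in>{0<..}. SUP \<rho>\<in>{-1<..<1}. ?P C \<mu>0 \<sigma>2 \<rho>) \<le> \<delta>"
      by (rule cSUP3_le[OF ne0]) (metis null[OF e] C)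
    with \<open>0 < C\<close> show ?thesis
      by blast
  qed
  show ?thesis
  proof (intro conjI impI allI)
    fix C c :: real and \<rho> :: "nat \<Rightarrow> real"
    assume e: ?e and "0 < C" "0 < c" and \<rho>: "(\<forall>m. \<rho> m \<in> {-1<..<1}) \<and> (\<lambda>m. \<bar>\<rho> m\<bar>) \<longlonglongrightarrow> 1"
    then have "\<bar>\<rho> m\<bar> < 1" for m
      by (simp add: abs_less_iff)
    with e \<rho> \<open>0 < C\<close> \<open>0 < c\<close> show "(\<lambda>m. INF (\<mu>1, \<sigma>2)\<in>{(\<mu>1, \<sigma>2). \<mu>1 \<in> mspan1 X R r \<and> 0 < \<sigma>2 \<and>
        infdist \<mu>1 (mspan0 X R r) / sqrt \<sigma>2 \<ge> c}. ?P C \<mu>1 \<sigma>2 (\<rho> m)) \<longlonglongrightarrow> 1"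
      by (intro power_tendsto_1_near_unit_root) blast+
  next
    fix C \<epsilon> :: real and c \<sigma>2 :: "nat \<Rightarrow> real"
    assume "0 < C" and "(\<forall>m. 0 < c m) \<and> (\<forall>m. 0 < \<sigma>2 m) \<and> 0 < \<epsilon> \<and> \<epsilon> < 1 \<and>
        filterlim (\<lambda>m. c m / sqrt (\<sigma>2 m)) at_top sequentially"
    then show "(\<lambda>m. INF \<mu>1\<in>{\<mu>1 \<in> mspan1 X R r. infdist \<mu>1 (mspan0 X R r) \<ge> c m}.
        INF \<rho>\<in>{-1 + \<epsilon>..1 - \<epsilon>}. ?P C \<mu>1 (\<sigma>2 m) \<rho>) \<longlonglongrightarrow> 1"
      by (intro power_tendsto_1_away_from_unit_root) blast+
  qed (use size null_pos power_pos small in blast)+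
qed

end
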